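(* Let $r\in\mathbb{N}$ be a positive integer and $b\ge 2$ a squarefree integer such that $P(X)=X^3+3rbX-b\in\mathbb{Z}[X]$ is monogenic, with negative discriminant $d_P=-27b^2(4r^3b+1)<0$, and let $\theta$ be the real zero of $P(X)$. Then the non-unitary absolute differential principal factor $\theta$ of the simply real cubic number field $L=\mathbb{Q}(\theta)$, with discriminant $d_L=d_P$ and maximal order $\mathcal{O}_L=\mathbb{Z}[\theta]$, is always a lattice minimum in $\mathrm{Min}(\mathcal{O}_L)$ (and thus can be found with the Voronoi algorithm, i.e. $\theta=\nu^i(1)$ for some $i\in\mathbb{Z}$). The two-sided chain $(\nu^i(1))_{i\in\mathbb{Z}}$ of lattice minima $\nu^i(1)\in\mathrm{Min}(\mathcal{O}_L)$ is always at least an $\mathrm{M}1$-chain (possibly even an $\mathrm{M}2$-chain).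
   Context: $P$ is monogenic if it is irreducible and $\mathbb{Z}[\theta]=\mathcal{O}_L$ for a zero $\theta$ and $L=\mathbb{Q}(\theta)$. Let $L\subset\mathbb{R}$ be a simply real cubic field; for $\alpha\in L$ let $\alpha',\alpha''$ be the two complex conjugates, so $\alpha'\alpha''=|\alpha'|^2$. A lattice minimum of $\mathcal{O}_L$ is an element $\alpha\in\mathcal{O}_L$, $\alpha>0$, such that no non-zero $\nu\in\mathcal{O}_L$ satisfies $|\nu|<\alpha$ and $\nu'\nu''<\alpha'\alpha''$; $\mathrm{Min}(\mathcal{O}_L)$ is the set of these. For $\alpha\in\mathrm{Min}(\mathcal{O}_L)$, $\nu(\alpha)$ denotes the lattice minimum with the largest real value smaller than $\alpha$; $\nu$ is a bijection and $\mathrm{Min}(\mathcal{O}_L)=\{\nu^i(1):i\in\mathbb{Z}\}$ (the Voronoi chain). The group $U_L^+$ of positive units of $\mathcal{O}_L$ acts on $\mathrm{Min}(\mathcal{O}_L)$ by multiplication. A (non-unitary absolute) differential principal factor is a non-unit $\alpha\in\mathcal{O}_L$ generating an ambiguous ideal, i.e. $\alpha^3/\mathrm{N}_{L/\mathbb{Q}}(\alpha)$ is a unit, and such that $\alpha\mathcal{O}_L$ is not generated by a rational number. The chain is an $\mathrm{M}2$-, $\mathrm{M}1$-, $\mathrm{M}0$-chain if $\mathrm{Min}(\mathcal{O}_L)$ contains exactly $2$, $1$, $0$ orbits, respectively, of non-unitary differential principal factors; "at least an $\mathrm{M}1$-chain" means an $\mathrm{M}1$- or an $\mathrm{M}2$-chain.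 *)

theory Defs
  imports
    Complex_Main
    "HOL-Library.FuncSet"
    "HOL-Computational_Algebra.Computational_Algebra"
    "Subresultants.Resultant_Prelim"
begin

section \<open>Fields, orders and embeddings\<close>

definition is_subfield :: "'a::field set \<Rightarrow> bool" where
  "is_subfield K \<longleftrightarrow> 0 \<in> K \<and> 1 \<in> K \<and>
     (\<forall>x\<in>K. \<forall>y\<in>K. x - y \<in> K \<and> x * y \<in> K) \<and> (\<forall>x\<in>K. inverse x \<in> K)"

text \<open>In characteristic 0 every subfield contains the rational numbers, so the smallest
  subfield containing x is \<open>\<rat>(x)\<close>.\<close>

definition rat_adjoin :: "'a::field_char_0 \<Rightarrow> 'a set" where
  "rat_adjoin x = is_subfield hull {x}"

definition int_adjoin :: "'a::field_char_0 \<Rightarrow> 'a set" where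
  "int_adjoin x = range (\<lambda>p :: int poly. poly (map_poly of_int p) x)"

definition maximal_order :: "'a::field_char_0 set \<Rightarrow> 'a set" where
  "maximal_order L = {x \<in> L. algebraic_int x}"

definition monogenic :: "int poly \<Rightarrow> bool" where
  "monogenic P \<longleftrightarrow> irreducible P \<and>
     (\<exists>z::complex. poly (map_poly of_int P) z = 0 \<and>
        int_adjoin z = maximal_order (rat_adjoin z))"

definition rat_degree :: "'a::field_char_0 set \<Rightarrow> nat" where
  "rat_degree L = vector_space.dim (\<lambda>(q::rat) x. of_rat q * x) L"

text \<open>Embeddings are normalised outside L, so that they can be counted.\<close>

definition embeddings :: "'a::field_char_0 set \<Rightarrow> ('a \<Rightarrow> complex) set" where
  "embeddings L = {\<sigma> \<in> extensional L. \<sigma> 1 = 1 \<and>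
     (\<forall>x\<in>L. \<forall>y\<in>L. \<sigma> (x + y) = \<sigma> x + \<sigma> y \<and> \<sigma> (x * y) = \<sigma> x * \<sigma> y)}"

definition real_embeddings :: "'a::field_char_0 set \<Rightarrow> ('a \<Rightarrow> complex) set" where
  "real_embeddings L = {\<sigma> \<in> embeddings L. \<sigma> ` L \<subseteq> \<real>}"

definition simply_real_cubic :: "real set \<Rightarrow> bool" where
  "simply_real_cubic L \<longleftrightarrow>
     is_subfield L \<and> rat_degree L = 3 \<and> card (real_embeddings L) = 1"


section \<open>Discriminants\<close>

definition poly_discriminant :: "int poly \<Rightarrow> int" where
  "poly_discriminant P =
     (-1) ^ (degree P * (degree P - 1) div 2) * resultant P (pderiv P) div lead_coeff P"

definition integral_basis :: "'a::field_char_0 set \<Rightarrow> nat \<Rightarrow> (nat \<Rightarrow> 'a) \<Rightarrow> bool" where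
  "integral_basis L n \<omega> \<longleftrightarrow> (\<forall>i<n. \<omega> i \<in> maximal_order L) \<and>
     (\<forall>x\<in>maximal_order L. \<exists>!c :: nat \<Rightarrow> int.
        c \<in> extensional {..<n} \<and> x = (\<Sum>i<n. of_int (c i) * \<omega> i))"

text \<open>The square of the determinant of the conjugates of an integral basis; it depends neither
  on the basis nor on the enumeration of the embeddings.\<close>

definition field_discriminant :: "'a::field_char_0 set \<Rightarrow> int" where
  "field_discriminant L = (THE D. \<exists>\<omega> \<sigma>. let n = rat_degree L in
     integral_basis L n \<omega> \<and> bij_betw \<sigma> {..<n} (embeddings L) \<and>
     of_int D = (det (mat n n (\<lambda>(i, j). \<sigma> i (\<omega> j))))\<^sup>2)"


section \<open>Lattice minima and the Voronoi chain\<close>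

text \<open>The product of the conjugates under all embeddings is rational, and in a simply real cubic
  field the product under the two non-real embeddings is real; \<open>Re\<close> only changes the type.\<close>

definition field_norm :: "real set \<Rightarrow> real \<Rightarrow> real" where
  "field_norm L x = Re (\<Prod>\<sigma>\<in>embeddings L. \<sigma> x)"

definition complex_conj_norm :: "real set \<Rightarrow> real \<Rightarrow> real" where
  "complex_conj_norm L x = Re (\<Prod>\<sigma>\<in>embeddings L - real_embeddings L. \<sigma> x)"

definition lattice_minima :: "real set \<Rightarrow> real set" where
  "lattice_minima L = {\<alpha> \<in> maximal_order L. \<alpha> > 0 \<and>
     \<not> (\<exists>\<nu>\<in>maximal_order L. \<nu> \<noteq> 0 \<and> \<bar>\<nu>\<bar> < \<alpha> \<and>
          complex_conj_norm L \<nu> < complex_conj_norm L \<alpha>)}"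

definition next_minimum :: "real set \<Rightarrow> real \<Rightarrow> real" where
  "next_minimum L \<alpha> = (GREATEST \<beta>. \<beta> \<in> lattice_minima L \<and> \<beta> < \<alpha>)"

definition voronoi_chain :: "real set \<Rightarrow> int \<Rightarrow> real" where
  "voronoi_chain L i =
     (if i \<ge> 0 then (next_minimum L ^^ nat i) 1
      else (inv_into (lattice_minima L) (next_minimum L) ^^ nat (- i)) 1)"


section \<open>Differential principal factors\<close>

definition order_units :: "real set \<Rightarrow> real set" where
  "order_units L = {\<epsilon> \<in> maximal_order L. \<epsilon> \<noteq> 0 \<and> inverse \<epsilon> \<in> maximal_order L}"

definition positive_units :: "real set \<Rightarrow> real set" where
  "positive_units L = {\<epsilon> \<in> order_units L. \<epsilon> > 0}"

definition differential_principal_factor :: "real set \<Rightarrow> real \<Rightarrow> bool" where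
  "differential_principal_factor L \<alpha> \<longleftrightarrow>
     \<alpha> \<in> maximal_order L \<and> \<alpha> \<notin> order_units L \<and>
     \<alpha> ^ 3 / field_norm L \<alpha> \<in> order_units L \<and>
     \<not> (\<exists>q\<in>\<rat>. (*) \<alpha> ` maximal_order L = (*) q ` maximal_order L)"

definition dpf_orbits :: "real set \<Rightarrow> real set set" where
  "dpf_orbits L = (\<lambda>\<alpha>. (\<lambda>\<epsilon>. \<epsilon> * \<alpha>) ` positive_units L) `
     {\<alpha> \<in> lattice_minima L. differential_principal_factor L \<alpha>}"

definition M_chain :: "nat \<Rightarrow> real set \<Rightarrow> bool" where
  "M_chain k L \<longleftrightarrow> finite (dpf_orbits L) \<and> card (dpf_orbits L) = k"

end

theory Submission
  imports Defs
begin

text \<open>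
  Put p = 3rb, so that \<open>\<theta> ^ 3 + p * \<theta> = b\<close>; then \<open>0 < \<theta> < 1 / (3 * r)\<close>, and p is at least 6. A
  polynomial of this shape with b squarefree has no rational zero, so 1, t, \<open>t\<^sup>2\<close> are linearly
  independent over the rationals for each of its zeros t. Multiplication in these coordinates does
  not depend on the choice of t. Hence integrality of an element depends only on its coordinates,
  and monogeneity at any one complex zero gives \<open>\<O>\<^sub>L = \<int>[\<theta>]\<close>. The nonreal zeros are
  \<open>\<omega>\<close> and its conjugate, with imaginary part at least \<open>sqrt p\<close> in absolute value.

  The zero \<open>\<theta>\<close> is a lattice minimum because the gap between \<open>\<theta>\<close> and \<open>\<omega>\<close> is large: if
  \<open>\<nu> = a + c * \<theta> + d * \<theta>\<^sup>2\<close> satisfies \<open>\<bar>\<nu>\<bar> < \<theta>\<close> and \<open>\<bar>\<nu>'\<bar> < \<bar>\<omega>\<bar>\<close>, then the differences of the conjugates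
  of \<open>\<nu>\<close> force d = 0 and \<open>\<bar>c\<bar> \<le> 1\<close>, and \<open>\<theta> < 1 / 3\<close> leaves only \<open>\<nu> = 0\<close>
  (\<open>lattice_point_below_theta_eq_0\<close>). It is a differential principal factor because
  \<open>\<theta> ^ 3 / b = 1 - 3 * r * \<theta>\<close>, an explicit unit \<open>\<eta>\<close> between 0 and 1.

  The powers of \<open>\<eta>\<close> are lattice minima that accumulate at 0 and are unbounded, while between two
  positive bounds there are only finitely many minima. A discrete set of this kind is
  enumerated by its successor map (\<open>discrete_minima_chain\<close>), which gives the Voronoi chain.

  For the number of orbits, the positive units form an infinite cyclic group, generated by some
  \<open>\<epsilon>\<close>, and \<open>\<alpha> ^ 3 / N \<alpha>\<close> is a power of \<open>\<epsilon>\<close> for every differential principal factor \<open>\<alpha> > 0\<close>. The residue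
  of the exponent modulo 3 determines the orbit. Indeed, if two exponents agree modulo 3 then the
  quotient of the two elements is, up to a unit, an element of L with rational cube. Such an element
  is itself rational (\<open>cube_rational_imp_rational\<close>), and proportional lattice minima coincide. The
  residue 0 would make \<open>\<alpha>\<close> generate the ideal of a rational number. So there are at most two orbits,
  and the orbit of \<open>\<theta>\<close> is one of them.

  That L contains no new cube roots of rational numbers, in other words is not a pure cubic field,
  is where monogeneity enters a second time. An irrational element with
  rational cube would make \<open>4 * r ^ 3 * b + 1\<close> the square of an integer m > 1, and then an explicit
  integral element with denominator m lies outside \<open>\<int>[\<theta>]\<close> (\<open>discriminant_factor_not_square\<close>).
\<close>

section \<open>Auxiliary facts on squarefree and square numbers\<close>

lemma squarefree_dvd_of_dvd_power:
  fixes a n :: "'a::factorial_semiring"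
  assumes "squarefree a" "a dvd n ^ k" "n \<noteq> 0"
  shows "a dvd n"
proof (rule multiplicity_le_imp_dvd)
  show "a \<noteq> 0" using assms(1) by auto
  fix p :: 'a assume p: "prime p"
  show "multiplicity p a \<le> multiplicity p n"
  proof (cases "p dvd a")
    case True
    then have "p dvd n" using assms(2) p by (meson dvd_trans prime_dvd_power)
    then have "multiplicity p n \<ge> 1"
      using p assms(3) by (auto simp: Suc_le_eq multiplicity_gt_zero_iff[OF assms(3)])
    moreover have "multiplicity p a \<le> 1"
      using assms(1) p \<open>a \<noteq> 0\<close> by (auto simp: squarefree_factorial_semiring'')
    ultimately show ?thesis by simp
  qed (simp add: not_dvd_imp_multiplicity_0)
qed

lemma square_rat_imp_square_int:
  assumes "(q::rat)\<^sup>2 = of_int n"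
  obtains m where "q = of_int m" "m\<^sup>2 = n"
proof -
  have "algebraic_int q"
    using algebraic_int_root[of "of_int n" "[:0,0,1:]" q] assms
    by (simp add: power2_eq_square coeff_pCons split: nat.splits)
  moreover have "q \<in> \<rat>" by (metis Rats_of_rat of_rat_eq_id id_apply)
  ultimately have "q \<in> \<int>" by (rule rational_algebraic_int_is_int)
  then obtain m where m: "q = of_int m" by (auto elim: Ints_cases)
  then have "of_int (m\<^sup>2) = (of_int n :: rat)" using assms by simp
  then have "m\<^sup>2 = n" by (simp only: of_int_eq_iff)
  then show thesis using that m by blast
qed

section \<open>Coordinates with respect to the powers of a zero\<close>

text \<open>Elements are handled through their coordinates, with the generator as an argument of an arbitrary
  type: the same coordinates then describe an element of \<open>\<rat>(\<theta>)\<close> and its conjugates.\<close>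

definition qcomb :: "'a::field_char_0 \<Rightarrow> rat \<Rightarrow> rat \<Rightarrow> rat \<Rightarrow> 'a" where
  "qcomb t a c d = of_rat a + of_rat c * t + of_rat d * t\<^sup>2"

lemma of_rat_eq_qcomb: "of_rat a = qcomb t a 0 0"
  by (simp add: qcomb_def)

lemma generator_eq_qcomb: "t = qcomb t 0 1 0"
  by (simp add: qcomb_def)

lemma qcomb_add: "qcomb t a c d + qcomb t a' c' d' = qcomb t (a + a') (c + c') (d + d')"
  by (simp add: qcomb_def of_rat_add algebra_simps)

lemma qcomb_diff: "qcomb t a c d - qcomb t a' c' d' = qcomb t (a - a') (c - c') (d - d')"
  by (simp add: qcomb_def of_rat_diff algebra_simps)

definition zcomb :: "'a::field_char_0 \<Rightarrow> int \<Rightarrow> int \<Rightarrow> int \<Rightarrow> 'a" where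
  "zcomb t a c d = of_int a + of_int c * t + of_int d * t\<^sup>2"

lemma zcomb_eq_qcomb: "zcomb t a c d = qcomb t (of_int a) (of_int c) (of_int d)"
  by (simp add: zcomb_def qcomb_def)

text \<open>The subfields considered here are closed under subtraction only; addition, and with it the
  integers, come from subtracting twice.\<close>

lemma subfield_of_rat:
  fixes K :: "'a::field_char_0 set"
  assumes "is_subfield K"
  shows "of_rat q \<in> K"
proof -
  have z: "0 \<in> K" and o: "1 \<in> K" and df: "\<And>x y. x \<in> K \<Longrightarrow> y \<in> K \<Longrightarrow> x - y \<in> K"
    and ml: "\<And>x y. x \<in> K \<Longrightarrow> y \<in> K \<Longrightarrow> x * y \<in> K" and iv: "\<And>x. x \<in> K \<Longrightarrow> inverse x \<in> K"
    using assms unfolding is_subfield_def by auto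
  have ng: "- x \<in> K" if "x \<in> K" for x using df[OF z that] by simp
  have ad: "x + y \<in> K" if "x \<in> K" "y \<in> K" for x y using df[OF that(1) ng[OF that(2)]] by simp
  have nt: "of_nat n \<in> K" for n by (induction n) (auto intro: z o ad)
  have it: "of_int n \<in> K" for n by (cases n rule: int_cases2) (auto intro: nt ng)
  obtain m n where "q = of_int m / of_int n" by (cases q) (auto simp: Fract_of_int_quotient)
  then have "of_rat q = (of_int m :: 'a) * inverse (of_int n)"
    by (simp add: of_rat_divide flip: divide_inverse)
  then show ?thesis using ml[OF it iv[OF it]] by simp
qed

lemma qcomb_in_rat_adjoin: "qcomb t a c d \<in> rat_adjoin t"
proof -
  have "qcomb t a c d \<in> K" if K: "is_subfield K" and t: "t \<in> K" for K
  proof -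
    have ml: "\<And>x y. x \<in> K \<Longrightarrow> y \<in> K \<Longrightarrow> x * y \<in> K"
      and df: "\<And>x y. x \<in> K \<Longrightarrow> y \<in> K \<Longrightarrow> x - y \<in> K" and z: "0 \<in> K"
      using K unfolding is_subfield_def by auto
    have ad: "x + y \<in> K" if "x \<in> K" "y \<in> K" for x y
      using df[OF that(1) df[OF z that(2)]] by simp
    show ?thesis unfolding qcomb_def power2_eq_square
      by (intro ad ml subfield_of_rat K t)
  qed
  then show ?thesis unfolding rat_adjoin_def hull_def by auto
qed

text \<open>The product has degree 4 in t; the two sides differ by a multiple of \<open>t ^ 3 - B + P * t\<close>.\<close>

lemma cubic_mult:
  fixes t :: "'a::comm_ring_1"
  assumes "t ^ 3 = B - P * t"
  shows "(a + c * t + d * t\<^sup>2) * (a' + c' * t + d' * t\<^sup>2) =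
    (a * a' + B * (c * d' + d * c')) + (a * c' + c * a' - P * (c * d' + d * c') + B * d * d') * t
      + (a * d' + c * c' + d * a' - P * d * d') * t\<^sup>2" (is "?l = ?r")
proof -
  have "?l - ?r = (c * d' + d * c' + d * d' * t) * (t ^ 3 - B + P * t)"
    by (simp add: algebra_simps power2_eq_square power3_eq_cube)
  then show ?thesis using assms by simp
qed

text \<open>The hypotheses on r and b that make \<open>X ^ 3 + 3 * r * b * X - b\<close> irreducible. The zeros are left
  open, since real and complex zeros have to be treated alike.\<close>

locale trinomial =
  fixes r :: nat and b :: int
  assumes r_pos: "r > 0" and b_ge_2: "b \<ge> 2" and b_squarefree: "squarefree b"
begin

definition is_zero :: "'a::field_char_0 \<Rightarrow> bool" where
  "is_zero t \<longleftrightarrow> t ^ 3 + 3 * of_nat r * of_int b * t = of_int b"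

abbreviation mul0 :: "rat \<Rightarrow> rat \<Rightarrow> rat \<Rightarrow> rat \<Rightarrow> rat \<Rightarrow> rat \<Rightarrow> rat" where
  "mul0 a c d a' c' d' \<equiv> a * a' + of_int b * (c * d' + d * c')"
abbreviation mul1 :: "rat \<Rightarrow> rat \<Rightarrow> rat \<Rightarrow> rat \<Rightarrow> rat \<Rightarrow> rat \<Rightarrow> rat" where
  "mul1 a c d a' c' d' \<equiv> a * c' + c * a' - 3 * of_nat r * of_int b * (c * d' + d * c') + of_int b * d * d'"
abbreviation mul2 :: "rat \<Rightarrow> rat \<Rightarrow> rat \<Rightarrow> rat \<Rightarrow> rat \<Rightarrow> rat \<Rightarrow> rat" where
  "mul2 a c d a' c' d' \<equiv> a * d' + c * c' + d * a' - 3 * of_nat r * of_int b * d * d'"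

lemma qcomb_mult:
  assumes "is_zero t"
  shows "qcomb t a c d * qcomb t a' c' d' =
    qcomb t (mul0 a c d a' c' d') (mul1 a c d a' c' d') (mul2 a c d a' c' d')"
proof -
  have "t ^ 3 = of_int b - 3 * of_nat r * of_int b * t"
    using assms by (simp add: is_zero_def algebra_simps)
  from cubic_mult[OF this] show ?thesis
    unfolding qcomb_def of_rat_add of_rat_diff of_rat_mult of_rat_of_int_eq of_rat_of_nat_eq of_rat_numeral_eq .
qed

lemma is_zero_iff_poly:
  "is_zero t \<longleftrightarrow> poly (map_poly of_int [:- b, 3 * int r * b, 0, 1:]) t = 0"
  by (simp add: is_zero_def of_int_hom.map_poly_pCons_hom algebra_simps power3_eq_cube eq_neg_iff_add_eq_0)

text \<open>A rational zero n would be an integer with \<open>b dvd n ^ 3\<close>. As b is squarefree it would divide n,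
  hence \<open>b\<^sup>2\<close> would divide \<open>n ^ 3 + 3 * r * b * n = b\<close>.\<close>

lemma no_rational_zero: "\<not> is_zero (q::rat)"
proof
  assume q: "is_zero q"
  have "algebraic_int q"
    unfolding algebraic_int_altdef_ipoly
  proof (intro exI conjI)
    show "poly (map_poly of_int [:- b, 3 * int r * b, 0, 1:]) q = 0"
      using q by (simp add: is_zero_def map_poly_pCons algebra_simps power3_eq_cube)
  qed simp
  moreover have "q \<in> \<rat>" by (metis Rats_of_rat of_rat_eq_id id_apply)
  ultimately have "q \<in> \<int>" by (rule rational_algebraic_int_is_int)
  then obtain n where n: "q = of_int n" by (auto elim: Ints_cases)
  have "of_int (n ^ 3 + 3 * int r * b * n) = (of_int b :: rat)"
    using q by (simp add: is_zero_def n)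
  then have n3: "n ^ 3 + 3 * int r * b * n = b" using of_int_eq_iff by blast
  then have "n ^ 3 = b * (1 - 3 * int r * n)" by (simp add: algebra_simps)
  then have "b dvd n ^ 3" by simp
  then have "b dvd n" using squarefree_dvd_of_dvd_power[OF b_squarefree] by (cases "n = 0") auto
  then obtain k where k: "n = b * k" by auto
  have "b * (b\<^sup>2 * k ^ 3 + 3 * int r * b * k) = b * 1" using n3 k by (simp add: algebra_simps power2_eq_square power3_eq_cube)
  then have "b\<^sup>2 * k ^ 3 + 3 * int r * b * k = 1" using b_ge_2 unfolding mult_cancel_left by simp
  then have "b * (b * k ^ 3 + 3 * int r * k) = 1" by (simp add: algebra_simps power2_eq_square)
  then have "b dvd 1" by (metis dvd_triv_left)
  then show False using b_ge_2 unfolding zdvd1_eq by simp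
qed

lemma zero_of_rat: "is_zero (of_rat q :: 'a::field_char_0) \<Longrightarrow> is_zero q"
proof -
  assume "is_zero (of_rat q :: 'a)"
  then have "(of_rat (q ^ 3 + 3 * of_nat r * of_int b * q) :: 'a) = of_rat (of_int b)"
    by (simp add: is_zero_def of_rat_add of_rat_mult of_rat_power)
  then show ?thesis unfolding is_zero_def of_rat_eq_iff .
qed

lemma irrational_zero:
  assumes t: "is_zero (t::'a::field_char_0)" shows "t \<noteq> of_rat q"
  using no_rational_zero zero_of_rat t by blast

text \<open>Linear independence of 1, t, \<open>t\<^sup>2\<close> over the rationals. If \<open>t\<^sup>2 = u * t + v\<close>, then reducing
  \<open>t ^ 3\<close> with this relation and comparing with the cubic equation gives a linear relation for t. It must be
  trivial, and it says that \<open>- u\<close> is a rational zero.\<close>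

lemma qcomb_eq_0_iff:
  assumes t: "is_zero (t::'a::field_char_0)"
  shows "qcomb t a c d = 0 \<longleftrightarrow> a = 0 \<and> c = 0 \<and> d = 0"
proof
  assume e: "qcomb t a c d = 0"
  have lin: "u = 0" if "of_rat u * t = of_rat v" for u v :: rat
  proof (rule ccontr)
    assume "u \<noteq> 0"
    then have "t = of_rat (v / u)" using that by (simp add: of_rat_divide field_simps)
    then show False using irrational_zero[OF t] by blast
  qed
  have d0: "d = 0"
  proof (rule ccontr)
    assume d: "d \<noteq> 0"
    \<comment> \<open>The relation is solved for the square of t.\<close>
    define u v where "u = - c / d" and "v = - a / d"
    have du: "of_rat d * of_rat u = (- of_rat c :: 'a)" "of_rat d * of_rat v = (- of_rat a :: 'a)"
      using d by (simp_all add: u_def v_def of_rat_minus flip: of_rat_mult)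
    have "of_rat d * t\<^sup>2 = (- of_rat c) * t + (- of_rat a)"
      using e unfolding qcomb_def by (auto simp: eq_diff_eq eq_neg_iff_add_eq_0 ac_simps)
    also have "\<dots> = of_rat d * (of_rat u * t + of_rat v)"
      by (simp only: du[symmetric] distrib_left mult.assoc)
    finally have "of_rat d * t\<^sup>2 = of_rat d * (of_rat u * t + of_rat v)" .
    then have t2: "t\<^sup>2 = of_rat u * t + of_rat v" using d by simp
    have t3: "t ^ 3 = of_int b - 3 * of_nat r * of_int b * t"
      using t by (simp add: is_zero_def algebra_simps)
    have "t ^ 3 = t\<^sup>2 * t" by (simp add: power2_eq_square power3_eq_cube)
    also have "\<dots> = of_rat u * t\<^sup>2 + of_rat v * t" by (subst t2) (simp add: algebra_simps power2_eq_square)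
    also have "\<dots> = of_rat u * (of_rat u * t + of_rat v) + of_rat v * t" by (simp only: t2)
    finally have uv: "of_rat (u\<^sup>2 + v + 3 * of_nat r * of_int b) * t = of_rat (of_int b - u * v)"
      using t3 by (simp add: of_rat_add of_rat_diff of_rat_mult of_rat_power algebra_simps power2_eq_square)
    from lin[OF uv] have 1: "u\<^sup>2 + v + 3 * of_nat r * of_int b = 0" .
    then have "of_int b - u * v = 0" using uv by simp
    moreover have "(- u) ^ 3 + 3 * of_nat r * of_int b * - u = - u * (u\<^sup>2 + v + 3 * of_nat r * of_int b) + u * v"
      by (simp add: algebra_simps power2_eq_square power3_eq_cube)
    ultimately have "is_zero (- u)" using 1 unfolding is_zero_def by simp
    then show False using no_rational_zero by blast
  qed
  then have "of_rat c * t = of_rat (- a)" using e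
    by (simp add: qcomb_def of_rat_minus eq_neg_iff_add_eq_0 add.commute)
  note this' = this
  then have c0: "c = 0" by (rule lin)
  then show "a = 0 \<and> c = 0 \<and> d = 0" using this' d0 by simp
qed (simp add: qcomb_def)

lemma qcomb_eq_iff:
  assumes t: "is_zero (t::'a::field_char_0)"
  shows "qcomb t a c d = qcomb t a' c' d' \<longleftrightarrow> a = a' \<and> c = c' \<and> d = d'"
  using qcomb_eq_0_iff[OF t, of "a - a'" "c - c'" "d - d'"]
  unfolding qcomb_diff[of t a c d a' c' d', symmetric] right_minus_eq .

text \<open>The coordinates of \<open>q(a + c * t + d * t\<^sup>2)\<close> do not depend on the zero t.\<close>

lemma poly_qcomb:
  assumes t: "is_zero (t::'a::field_char_0)" and z: "is_zero (z::'b::field_char_0)"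
  obtains A C D where "poly (map_poly of_int q) (qcomb t a c d) = qcomb t A C D"
    "poly (map_poly of_int q) (qcomb z a c d) = qcomb z A C D"
proof -
  have "\<exists>A C D. poly (map_poly of_int q) (qcomb t a c d) = qcomb t A C D \<and>
    poly (map_poly of_int q) (qcomb z a c d) = qcomb z A C D"
  proof (induction q)
    case 0
    show ?case by (rule exI[of _ 0], rule exI[of _ 0], rule exI[of _ 0]) (simp add: qcomb_def)
  next
    case (pCons n q)
    then obtain A C D where *: "poly (map_poly of_int q) (qcomb t a c d) = qcomb t A C D"
      "poly (map_poly of_int q) (qcomb z a c d) = qcomb z A C D" by blast
    have **: "of_int n = qcomb t (of_int n) 0 0" "of_int n = qcomb z (of_int n) 0 0" by (simp_all add: qcomb_def)
    show ?case
      by (simp only: of_int_hom.map_poly_pCons_hom poly_pCons * ** qcomb_mult[OF t] qcomb_mult[OF z] qcomb_add) blast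
  qed
  then show thesis using that by blast
qed

text \<open>Elements with the same coordinates with respect to two zeros are conjugate, so an integral
  equation for one holds for the other.\<close>

lemma algebraic_int_qcomb_transfer:
  assumes t: "is_zero (t::'a::field_char_0)" and z: "is_zero (z::'b::field_char_0)"
    and "algebraic_int (qcomb t a c d)"
  shows "algebraic_int (qcomb z a c d)"
proof -
  obtain q where q: "poly (map_poly of_int q) (qcomb t a c d) = 0" "lead_coeff q = 1"
    using assms(3) unfolding algebraic_int_altdef_ipoly by auto
  obtain A C D where "poly (map_poly of_int q) (qcomb t a c d) = qcomb t A C D"
    "poly (map_poly of_int q) (qcomb z a c d) = qcomb z A C D"
    using poly_qcomb[OF t z] by blast
  then have "poly (map_poly of_int q) (qcomb z a c d) = 0"
    using q qcomb_eq_0_iff[OF t, of A C D] qcomb_eq_0_iff[OF z, of A C D] by simp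
  then show ?thesis using q unfolding algebraic_int_altdef_ipoly by blast
qed

lemma int_adjoin_eq:
  assumes t: "is_zero (t::'a::field_char_0)"
  shows "int_adjoin t = {zcomb t a c d | a c d. True}"
proof (intro equalityI subsetI)
  fix x assume "x \<in> int_adjoin t"
  then obtain q where q: "x = poly (map_poly of_int q) t" by (auto simp: int_adjoin_def)
  have t3: "t ^ 3 = of_int b - 3 * of_nat r * of_int b * t"
      using t by (simp add: is_zero_def algebra_simps)
  have "\<exists>a c d. poly (map_poly of_int q) t = zcomb t a c d"
  proof (induction q)
    case 0
    show ?case by (rule exI[of _ 0], rule exI[of _ 0], rule exI[of _ 0]) (simp add: zcomb_def)
  next
    case (pCons n q)
    then obtain a c d where *: "poly (map_poly of_int q) t = zcomb t a c d" by blast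
    have "of_int n + t * zcomb t a c d = zcomb t (n + b * d) (a - 3 * int r * b * d) c"
      using cubic_mult[OF t3, of 0 1 0 "of_int a" "of_int c" "of_int d"]
      unfolding zcomb_def by (simp add: algebra_simps)
    then show ?case by (simp only: of_int_hom.map_poly_pCons_hom poly_pCons *) blast
  qed
  then show "x \<in> {zcomb t a c d | a c d. True}" using q by blast
next
  fix x assume "x \<in> {zcomb t a c d | a c d. True}"
  then obtain a c d where "x = zcomb t a c d" by blast
  then have "x = poly (map_poly of_int [:a, c, d:]) t"
    by (simp add: zcomb_def of_int_hom.map_poly_pCons_hom algebra_simps power2_eq_square)
  then show "x \<in> int_adjoin t" unfolding int_adjoin_def by blast
qed

end

section \<open>The cubic field, its embeddings and its norm form\<close>

lemma of_real_of_rat: "of_real (of_rat q) = (of_rat q :: complex)"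
proof -
  obtain m k where "q = of_int m / of_int k" by (cases q) (auto simp: Fract_of_int_quotient)
  then show ?thesis by (simp add: of_rat_divide)
qed

lemma cnj_qcomb: "cnj (qcomb z a c d) = qcomb (cnj z) a c d"
  unfolding qcomb_def by (simp flip: of_real_of_rat)

lemma of_real_qcomb: "of_real (qcomb x a c d) = (qcomb (of_real x) a c d :: complex)"
  unfolding qcomb_def by (simp flip: of_real_of_rat)

locale trinomial_field = trinomial +
  fixes \<theta> :: real
  assumes zero_theta: "is_zero \<theta>"
begin

abbreviation L :: "real set" where "L \<equiv> rat_adjoin \<theta>"

abbreviation p :: real where "p \<equiv> 3 * real r * of_int b"

lemma p_ge_6: "p \<ge> 6"
proof -
  have "3 * real r * of_int b \<ge> 3 * 1 * 2"
    using r_pos b_ge_2 by (intro mult_mono) auto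
  then show ?thesis by simp
qed

lemma theta_cubed: "\<theta> ^ 3 = of_int b - p * \<theta>"
  using zero_theta by (simp add: is_zero_def)

lemma theta_pos: "\<theta> > 0"
proof (rule ccontr)
  assume "\<not> \<theta> > 0"
  then have "\<theta> ^ 3 \<le> 0" by simp
  moreover have "p * \<theta> \<le> 0" using \<open>\<not> \<theta> > 0\<close> p_ge_6 by (intro mult_nonneg_nonpos) auto
  moreover have "real_of_int b > 0" using b_ge_2 by simp
  ultimately show False using theta_cubed by linarith
qed

lemma r_theta_less: "3 * real r * \<theta> < 1"
proof -
  have "p * \<theta> < of_int b" using theta_cubed zero_less_power[OF theta_pos, of 3] by linarith
  then have "of_int b * (3 * real r * \<theta>) < of_int b * 1" by (simp add: algebra_simps)
  then show ?thesis using b_ge_2 by (subst (asm) mult_less_cancel_left_pos) auto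
qed

lemma theta_less: "\<theta> < 1 / 3"
proof -
  have "3 * 1 * \<theta> \<le> 3 * real r * \<theta>" using r_pos theta_pos by (intro mult_right_mono) auto
  then show ?thesis using r_theta_less by simp
qed

text \<open>The zero in the upper half plane: it is a zero of the quadratic cofactor
  \<open>X\<^sup>2 + \<theta> * X + \<theta>\<^sup>2 + p\<close> of \<open>X - \<theta>\<close>.\<close>

definition \<omega> :: complex where
  "\<omega> = Complex (- \<theta> / 2) (sqrt (p + 3 * \<theta>\<^sup>2 / 4))"

lemma Re_omega: "Re \<omega> = - \<theta> / 2" by (simp add: \<omega>_def)

lemma Im_omega_sq: "(Im \<omega>)\<^sup>2 = p + 3 * \<theta>\<^sup>2 / 4"
  using p_ge_6 by (simp add: \<omega>_def)

lemma Im_omega_pos: "Im \<omega> > 0"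
  using p_ge_6 by (simp add: \<omega>_def add_pos_nonneg)

lemma omega_add_cnj: "\<omega> + cnj \<omega> = - of_real \<theta>"
  by (simp add: complex_eq_iff Re_omega)

lemma cmod_omega_sq: "(cmod \<omega>)\<^sup>2 = \<theta>\<^sup>2 + p"
  by (simp add: cmod_power2 Re_omega Im_omega_sq field_simps)

lemma omega_mult_cnj: "\<omega> * cnj \<omega> = of_real (\<theta>\<^sup>2 + p)"
  by (simp add: cmod_omega_sq flip: complex_norm_square)

lemma zero_of_real_theta: "is_zero (of_real \<theta> :: complex)"
proof -
  have "(of_real (\<theta> ^ 3 + p * \<theta>) :: complex) = of_real (of_int b)"
    using theta_cubed by simp
  then show ?thesis by (simp add: is_zero_def)
qed

lemma complex_zero_iff: "is_zero (z::complex) \<longleftrightarrow> z \<in> {of_real \<theta>, \<omega>, cnj \<omega>}"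
proof -
  have t: "(of_real \<theta> :: complex) ^ 3 = of_int b - of_real p * of_real \<theta>"
    using zero_of_real_theta by (simp add: is_zero_def algebra_simps)
  have "(z - \<omega>) * (z - cnj \<omega>) = z\<^sup>2 - (\<omega> + cnj \<omega>) * z + \<omega> * cnj \<omega>"
    by (simp add: algebra_simps power2_eq_square)
  also have "\<dots> = z\<^sup>2 + of_real \<theta> * z + of_real (\<theta>\<^sup>2 + p)"
    by (simp add: omega_add_cnj omega_mult_cnj)
  finally have "(z - of_real \<theta>) * ((z - \<omega>) * (z - cnj \<omega>)) =
    z ^ 3 + of_real p * z - (of_real \<theta> ^ 3 + of_real p * of_real \<theta>)"
    by (simp add: algebra_simps power2_eq_square power3_eq_cube)
  also have "\<dots> = z ^ 3 + of_real p * z - of_int b"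
    by (simp add: t)
  finally show ?thesis by (auto simp: is_zero_def)
qed

lemma zero_omega: "is_zero \<omega>" and zero_cnj_omega: "is_zero (cnj \<omega>)"
  by (simp_all add: complex_zero_iff)

lemma complex_zeros_distinct: "of_real \<theta> \<noteq> \<omega>" "of_real \<theta> \<noteq> cnj \<omega>" "\<omega> \<noteq> cnj \<omega>"
  using Im_omega_pos by (auto simp: complex_eq_iff)

abbreviation adj0 :: "rat \<Rightarrow> rat \<Rightarrow> rat \<Rightarrow> rat" where
  "adj0 a c d \<equiv> a\<^sup>2 + 3 * of_nat r * of_int b * c\<^sup>2 + (3 * of_nat r * of_int b)\<^sup>2 * d\<^sup>2
     - 2 * (3 * of_nat r * of_int b) * a * d - of_int b * c * d"
abbreviation adj1 :: "rat \<Rightarrow> rat \<Rightarrow> rat \<Rightarrow> rat" where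
  "adj1 a c d \<equiv> of_int b * d\<^sup>2 - a * c"
abbreviation adj2 :: "rat \<Rightarrow> rat \<Rightarrow> rat \<Rightarrow> rat" where
  "adj2 a c d \<equiv> c\<^sup>2 + 3 * of_nat r * of_int b * d\<^sup>2 - a * d"

text \<open>The product of the two nonreal conjugates of an element of \<open>L\<close> lies in \<open>L\<close> again, since it is
  symmetric in \<open>\<omega>\<close> and its conjugate. Its coordinates \<open>adj0\<close>, \<open>adj1\<close>, \<open>adj2\<close> are integral polynomials; they
  provide inverses in \<open>L\<close> and the norm form.\<close>

lemma cmod_qcomb_omega:
  "(cmod (qcomb \<omega> a c d))\<^sup>2 = qcomb \<theta> (adj0 a c d) (adj1 a c d) (adj2 a c d)"
proof -
  define A C D where ACD: "A = real_of_rat a" "C = real_of_rat c" "D = real_of_rat d"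
  define s where "s = Im \<omega>"
  have s2: "s\<^sup>2 = p + 3 * \<theta>\<^sup>2 / 4" by (simp add: s_def Im_omega_sq)
  have R: "Re (qcomb \<omega> a c d) = A + C * (- \<theta> / 2) + D * (\<theta>\<^sup>2 / 4 - s\<^sup>2)"
    and I: "Im (qcomb \<omega> a c d) = s * (C - D * \<theta>)"
    unfolding qcomb_def ACD s_def
    by (simp_all add: Re_omega Re_power2 Im_power2 power_divide algebra_simps flip: of_real_of_rat)
  have t3: "\<theta> ^ 3 = of_int b - p * \<theta>" by (rule theta_cubed)
  have t4: "\<theta> ^ 4 = of_int b * \<theta> - p * \<theta>\<^sup>2"
    using arg_cong[OF t3, of "\<lambda>x. x * \<theta>"] by (simp add: algebra_simps power2_eq_square power_numeral_reduce)
  have "(cmod (qcomb \<omega> a c d))\<^sup>2 = (A + C * (- \<theta> / 2) + D * (\<theta>\<^sup>2 / 4 - s\<^sup>2))\<^sup>2 + s\<^sup>2 * (C - D * \<theta>)\<^sup>2"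
    by (simp add: cmod_power2 R I power_mult_distrib)
  also have "\<dots> = A\<^sup>2 + C\<^sup>2 * (\<theta>\<^sup>2 + p) + D\<^sup>2 * (\<theta> ^ 4 + 2 * p * \<theta>\<^sup>2 + p\<^sup>2)
       - A * C * \<theta> - A * D * (\<theta>\<^sup>2 + 2 * p) - C * D * (\<theta> ^ 3 + p * \<theta>)"
    unfolding s2 by (simp add: field_simps power2_eq_square power3_eq_cube power_numeral_reduce)
  also have "\<dots> = (A\<^sup>2 + p * C\<^sup>2 + p\<^sup>2 * D\<^sup>2 - 2 * p * A * D - of_int b * C * D) + (of_int b * D\<^sup>2 - A * C) * \<theta>
       + (C\<^sup>2 + p * D\<^sup>2 - A * D) * \<theta>\<^sup>2"
    unfolding t3 t4 by (simp add: algebra_simps)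
  finally show ?thesis
    unfolding qcomb_def ACD by (simp add: of_rat_add of_rat_diff of_rat_mult of_rat_power)
qed

abbreviation norm_form :: "'a::comm_ring_1 \<Rightarrow> 'a \<Rightarrow> 'a \<Rightarrow> 'a" where
  "norm_form a c d \<equiv> a ^ 3 + 3 * of_nat r * of_int b * a * c\<^sup>2 + (3 * of_nat r * of_int b)\<^sup>2 * a * d\<^sup>2
     - 2 * (3 * of_nat r * of_int b) * a\<^sup>2 * d + of_int b * c ^ 3
     + of_int b * (3 * of_nat r * of_int b) * c * d\<^sup>2 + of_int b ^ 2 * d ^ 3 - 3 * of_int b * a * c * d"

text \<open>An element times the product of its other conjugates is its norm, an integral cubic form in the
  coordinates.\<close>

lemma qcomb_mult_cmod:
  "qcomb \<theta> a c d * (cmod (qcomb \<omega> a c d))\<^sup>2 = of_rat (norm_form a c d)"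
  unfolding cmod_qcomb_omega qcomb_mult[OF zero_theta] of_rat_eq_qcomb[of _ \<theta>] qcomb_eq_iff[OF zero_theta]
  by (simp add: algebra_simps power2_eq_square power3_eq_cube)

lemma qcomb_omega_ne_0: "qcomb \<theta> a c d \<noteq> 0 \<Longrightarrow> qcomb \<omega> a c d \<noteq> 0"
  by (simp add: qcomb_eq_0_iff[OF zero_theta] qcomb_eq_0_iff[OF zero_omega])

lemma inverse_qcomb:
  assumes "qcomb \<theta> a c d \<noteq> 0"
  shows "inverse (qcomb \<theta> a c d) =
    of_rat (inverse (norm_form a c d)) * qcomb \<theta> (adj0 a c d) (adj1 a c d) (adj2 a c d)"
proof -
  have *: "inverse x = inverse n * y" if "x * y = n" "x \<noteq> 0" "y \<noteq> 0" for x y n :: real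
    using that by (auto simp: inverse_mult_distrib)
  have "(cmod (qcomb \<omega> a c d))\<^sup>2 \<noteq> 0" using qcomb_omega_ne_0[OF assms] by simp
  from *[OF qcomb_mult_cmod assms this] show ?thesis
    unfolding of_rat_inverse cmod_qcomb_omega .
qed

text \<open>The right-hand side is closed under inversion by \<open>inverse_qcomb\<close>, hence a subfield.\<close>

lemma L_eq: "L = {qcomb \<theta> a c d | a c d. True}"
proof
  have "is_subfield {qcomb \<theta> a c d | a c d. True}"
    unfolding is_subfield_def
  proof (intro conjI ballI)
    show "0 \<in> {qcomb \<theta> a c d | a c d. True}" using of_rat_eq_qcomb[of 0 \<theta>] by auto
    show "1 \<in> {qcomb \<theta> a c d | a c d. True}" using of_rat_eq_qcomb[of 1 \<theta>] by auto
  next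
    fix x y assume "x \<in> {qcomb \<theta> a c d | a c d. True}" "y \<in> {qcomb \<theta> a c d | a c d. True}"
    then obtain a c d a' c' d' where "x = qcomb \<theta> a c d" "y = qcomb \<theta> a' c' d'" by blast
    then show "x - y \<in> {qcomb \<theta> a c d | a c d. True}" "x * y \<in> {qcomb \<theta> a c d | a c d. True}"
      using qcomb_diff qcomb_mult[OF zero_theta] by blast+
  next
    fix x assume "x \<in> {qcomb \<theta> a c d | a c d. True}"
    then obtain a c d where x: "x = qcomb \<theta> a c d" by blast
    show "inverse x \<in> {qcomb \<theta> a c d | a c d. True}"
    proof (cases "x = 0")
      case True
      then show ?thesis using x by auto
    next
      case False
      then show ?thesis unfolding x
        by (subst inverse_qcomb) (auto simp: of_rat_eq_qcomb[of _ \<theta>] qcomb_mult[OF zero_theta])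
    qed
  qed
  moreover have "\<theta> \<in> {qcomb \<theta> a c d | a c d. True}" using generator_eq_qcomb[of \<theta>] by blast
  ultimately show "L \<subseteq> {qcomb \<theta> a c d | a c d. True}"
    unfolding rat_adjoin_def by (intro hull_minimal) auto
qed (auto intro: qcomb_in_rat_adjoin)

lemma subfield_L: "is_subfield L"
  unfolding rat_adjoin_def
  by (rule hull_in) (auto simp: is_subfield_def)

lemma L_cases:
  assumes "x \<in> L"
  obtains a c d where "x = qcomb \<theta> a c d"
  using assms L_eq by blast

text \<open>The embedding that sends \<open>\<theta>\<close> to z. The description is unique because the coordinates of x are;
  the restriction to \<open>L\<close> matches the normalisation of embeddings outside the field.\<close>

definition emb :: "complex \<Rightarrow> real \<Rightarrow> complex" where
  "emb z = (\<lambda>x\<in>L. THE y. \<exists>a c d. x = qcomb \<theta> a c d \<and> y = qcomb z a c d)"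

lemma emb_qcomb: "emb z (qcomb \<theta> a c d) = qcomb z a c d"
  unfolding emb_def using qcomb_in_rat_adjoin[of \<theta> a c d]
  by (auto simp: qcomb_eq_iff[OF zero_theta])

lemma emb_theta: "emb z \<theta> = z"
  by (subst generator_eq_qcomb, subst emb_qcomb) (simp add: qcomb_def)

lemma emb_of_rat: "emb z (of_rat q) = of_rat q"
  by (metis emb_qcomb of_rat_eq_qcomb)

lemma emb_add: "x \<in> L \<Longrightarrow> y \<in> L \<Longrightarrow> emb z (x + y) = emb z x + emb z y"
  by (elim L_cases) (simp add: qcomb_add emb_qcomb)

lemma emb_mult: "is_zero z \<Longrightarrow> x \<in> L \<Longrightarrow> y \<in> L \<Longrightarrow> emb z (x * y) = emb z x * emb z y"
  by (elim L_cases) (simp add: qcomb_mult emb_qcomb zero_theta)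

lemma emb_of_real_theta: "x \<in> L \<Longrightarrow> emb (of_real \<theta>) x = of_real x"
  by (elim L_cases) (simp add: of_real_qcomb emb_qcomb)

lemma emb_cnj: "x \<in> L \<Longrightarrow> emb (cnj z) x = cnj (emb z x)"
  by (elim L_cases) (simp add: cnj_qcomb emb_qcomb)

lemma emb_in_embeddings: "is_zero z \<Longrightarrow> emb z \<in> embeddings L"
  unfolding embeddings_def using emb_of_rat[of z 1]
  by (auto simp: emb_add emb_mult) (simp add: emb_def)

lemma embedding_of_rat:
  assumes s: "\<sigma> \<in> embeddings L"
  shows "\<sigma> (of_rat q) = of_rat q"
proof -
  have 1: "\<sigma> 1 = 1" and ad: "\<And>x y. x \<in> L \<Longrightarrow> y \<in> L \<Longrightarrow> \<sigma> (x + y) = \<sigma> x + \<sigma> y"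
    and ml: "\<And>x y. x \<in> L \<Longrightarrow> y \<in> L \<Longrightarrow> \<sigma> (x * y) = \<sigma> x * \<sigma> y"
    using s by (auto simp: embeddings_def)
  have rt: "of_rat q \<in> L" for q by (rule subfield_of_rat[OF subfield_L])
  have it: "of_int n \<in> L" for n using rt[of "of_int n"] by simp
  have nt: "of_nat n \<in> L" for n using rt[of "of_nat n"] by simp
  have "\<sigma> (0 + 0) = \<sigma> 0 + \<sigma> 0" using ad[OF rt[of 0] rt[of 0]] by simp
  then have 0: "\<sigma> 0 = 0" by simp
  have n: "\<sigma> (of_nat n) = of_nat n" for n
    using 0 1 ad nt[of n for n] nt[of 1] by (induction n) simp_all
  have i: "\<sigma> (of_int n) = of_int n" for n
  proof (cases n rule: int_cases2)
    case (nonpos m)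
    have "\<sigma> (of_int (- int m) + of_nat m) = \<sigma> (of_int (- int m)) + of_nat m"
      using ad[OF it nt] n by metis
    then have "\<sigma> (- of_nat m) + of_nat m = 0" using 0 by simp
    then have "\<sigma> (- of_nat m) = - of_nat m" by (simp only: eq_neg_iff_add_eq_0)
    then show ?thesis using nonpos(1) by simp
  qed (use n in simp)
  obtain m k where q: "q = of_int m / of_int k" and k: "k \<noteq> 0"
    by (cases q) (auto simp: Fract_of_int_quotient)
  have "\<sigma> (of_int k * of_rat q) = of_int k * \<sigma> (of_rat q)" using ml[OF it rt] i by simp
  moreover have "of_int k * of_rat q = (of_int m :: real)" using k by (simp add: q of_rat_divide)
  ultimately show ?thesis using i[of m] k by (simp add: q of_rat_divide field_simps)
qed

text \<open>An embedding fixes the rational numbers, so it is determined by the image of \<open>\<theta>\<close>, which is a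
  zero of the same polynomial.\<close>

lemma embeddings_eq: "embeddings L = emb ` {of_real \<theta>, \<omega>, cnj \<omega>}"
proof
  show "emb ` {of_real \<theta>, \<omega>, cnj \<omega>} \<subseteq> embeddings L"
    using emb_in_embeddings complex_zero_iff by blast
  show "embeddings L \<subseteq> emb ` {of_real \<theta>, \<omega>, cnj \<omega>}"
  proof
    fix \<sigma> assume s: "\<sigma> \<in> embeddings L"
    then have ad: "\<And>x y. x \<in> L \<Longrightarrow> y \<in> L \<Longrightarrow> \<sigma> (x + y) = \<sigma> x + \<sigma> y"
      and ml: "\<And>x y. x \<in> L \<Longrightarrow> y \<in> L \<Longrightarrow> \<sigma> (x * y) = \<sigma> x * \<sigma> y" and ext: "\<sigma> \<in> extensional L"
      by (auto simp: embeddings_def)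
    have rt: "of_rat q \<in> L" for q by (rule subfield_of_rat[OF subfield_L])
    have th: "\<theta> \<in> L" by (metis generator_eq_qcomb qcomb_in_rat_adjoin)
    have mlL: "x * y \<in> L" and adL: "x + y \<in> L" if "x \<in> L" "y \<in> L" for x y
      using that by (auto elim!: L_cases simp: qcomb_mult[OF zero_theta] qcomb_add intro: qcomb_in_rat_adjoin)
    define z where "z = \<sigma> \<theta>"
    have sel: "\<sigma> (qcomb \<theta> a c d) = qcomb z a c d" for a c d
      unfolding qcomb_def power2_eq_square z_def
      by (simp add: ad ml rt th mlL adL embedding_of_rat[OF s])
    have "\<sigma> (\<theta> * (\<theta> * \<theta>) + of_rat (3 * of_nat r * of_int b) * \<theta>) = z * (z * z) + of_rat (3 * of_nat r * of_int b) * z"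
      by (simp only: ad ml rt th mlL adL embedding_of_rat[OF s] z_def)
    moreover have "\<theta> * (\<theta> * \<theta>) + of_rat (3 * of_nat r * of_int b) * \<theta> = of_rat (of_int b)"
      using zero_theta by (simp add: is_zero_def power3_eq_cube of_rat_mult)
    ultimately have "is_zero z"
      using embedding_of_rat[OF s, of "of_int b"] by (simp add: is_zero_def power3_eq_cube of_rat_mult mult.assoc)
    moreover have "\<sigma> = emb z"
    proof (rule extensionalityI[OF ext])
      show "emb z \<in> extensional L" by (simp add: emb_def)
      show "\<sigma> x = emb z x" if "x \<in> L" for x using that by (auto elim!: L_cases simp: sel emb_qcomb)
    qed
    ultimately show "\<sigma> \<in> emb ` {of_real \<theta>, \<omega>, cnj \<omega>}" using complex_zero_iff by blast
  qed
qed

lemma inj_emb: "inj emb"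
  by (metis emb_theta injI)

lemma real_embeddings_eq: "real_embeddings L = {emb (of_real \<theta>)}"
proof -
  have th: "\<theta> \<in> L" by (metis generator_eq_qcomb qcomb_in_rat_adjoin)
  have "emb \<omega> \<theta> \<notin> \<real>" "emb (cnj \<omega>) \<theta> \<notin> \<real>"
    using Im_omega_pos by (auto simp: emb_theta complex_is_Real_iff)
  moreover have "emb (of_real \<theta>) ` L \<subseteq> \<real>" by (auto simp: emb_of_real_theta)
  ultimately show ?thesis unfolding real_embeddings_def embeddings_eq using th by blast
qed

definition conj_norm :: "real \<Rightarrow> real" where "conj_norm x = (cmod (emb \<omega> x))\<^sup>2"

lemma complex_conj_norm_eq:
  assumes "x \<in> L" shows "complex_conj_norm L x = conj_norm x"
proof -
  have "embeddings L - real_embeddings L = {emb \<omega>, emb (cnj \<omega>)}"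
    unfolding embeddings_eq real_embeddings_eq using complex_zeros_distinct inj_emb by (auto dest: injD)
  then show ?thesis
    using complex_zeros_distinct inj_emb assms
    by (simp add: complex_conj_norm_def conj_norm_def inj_eq emb_cnj cmod_power2) (simp add: power2_eq_square)
qed

lemma field_norm_eq:
  assumes "x \<in> L" shows "field_norm L x = x * conj_norm x"
proof -
  have "field_norm L x = Re (of_real x * (emb \<omega> x * cnj (emb \<omega> x)))"
    using complex_zeros_distinct inj_emb assms
    by (simp add: field_norm_def embeddings_eq inj_eq emb_cnj emb_of_real_theta)
  then show ?thesis by (simp add: conj_norm_def cmod_power2[unfolded power2_eq_square] power2_eq_square)
qed

lemma zcomb_in_L: "zcomb \<theta> a c d \<in> L"
  unfolding zcomb_eq_qcomb by (rule qcomb_in_rat_adjoin)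

lemma of_int_eq_zcomb: "of_int n = zcomb t n 0 0" by (simp add: zcomb_def)

lemma theta_eq_zcomb: "\<theta> = zcomb \<theta> 0 1 0" by (simp add: zcomb_def)

lemma zcomb_mult_closed:
  assumes "is_zero t" shows "\<exists>a'' c'' d''. zcomb t a c d * zcomb t a' c' d' = zcomb t a'' c'' d''"
proof -
  have "t ^ 3 = of_int b - 3 * of_nat r * of_int b * t"
    using assms by (simp add: is_zero_def algebra_simps)
  from cubic_mult[OF this, of "of_int a" "of_int c" "of_int d" "of_int a'" "of_int c'" "of_int d'"]
  have "zcomb t a c d * zcomb t a' c' d' = zcomb t (a * a' + b * (c * d' + d * c'))
    (a * c' + c * a' - 3 * int r * b * (c * d' + d * c') + b * d * d')
    (a * d' + c * c' + d * a' - 3 * int r * b * d * d')"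
    unfolding zcomb_def by simp
  then show ?thesis by blast
qed

lemma conj_norm_nonneg: "conj_norm x \<ge> 0" by (simp add: conj_norm_def)

lemma conj_norm_pos: "x \<in> L \<Longrightarrow> x \<noteq> 0 \<Longrightarrow> conj_norm x > 0"
  by (elim L_cases) (use qcomb_omega_ne_0 in \<open>auto simp: conj_norm_def emb_qcomb\<close>)

lemma conj_norm_mult: "x \<in> L \<Longrightarrow> y \<in> L \<Longrightarrow> conj_norm (x * y) = conj_norm x * conj_norm y"
  by (simp add: conj_norm_def emb_mult zero_omega norm_mult power_mult_distrib)

lemma conj_norm_of_rat: "conj_norm (of_rat q) = (of_rat q)\<^sup>2"
  unfolding conj_norm_def emb_of_rat of_real_of_rat[symmetric] norm_of_real by (rule power2_abs)

text \<open>Norms of elements of \<open>\<int>[\<theta>]\<close> are integers; lattice minima are controlled by this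
  discreteness.\<close>

lemma norm_zcomb: "zcomb \<theta> a c d * conj_norm (zcomb \<theta> a c d) = of_int (norm_form a c d)"
proof -
  have "zcomb \<theta> a c d * conj_norm (zcomb \<theta> a c d) = of_rat (norm_form (of_int a) (of_int c) (of_int d))"
    using qcomb_mult_cmod[of "of_int a" "of_int c" "of_int d"] unfolding conj_norm_def emb_qcomb zcomb_eq_qcomb .
  also have "norm_form (of_int a) (of_int c) (of_int d) = (of_int (norm_form a c d) :: rat)" by simp
  finally show ?thesis unfolding of_rat_of_int_eq .
qed

lemma norm_rational: "x \<in> L \<Longrightarrow> x * conj_norm x \<in> \<rat>"
  by (elim L_cases) (simp add: conj_norm_def emb_qcomb qcomb_mult_cmod)

lemma L_mult: "x \<in> L \<Longrightarrow> y \<in> L \<Longrightarrow> x * y \<in> L"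
  and L_inverse: "x \<in> L \<Longrightarrow> inverse x \<in> L"
  using subfield_L unfolding is_subfield_def by auto

lemma L_of_rat: "of_rat q \<in> L"
  using subfield_of_rat[OF subfield_L] .

lemma L_divide: "x \<in> L \<Longrightarrow> y \<in> L \<Longrightarrow> x / y \<in> L"
  by (simp add: divide_inverse L_mult L_inverse)

lemma theta_in_L: "\<theta> \<in> L"
  by (metis generator_eq_qcomb qcomb_in_rat_adjoin)

lemma conj_norm_inverse: "x \<in> L \<Longrightarrow> x \<noteq> 0 \<Longrightarrow> conj_norm (inverse x) = inverse (conj_norm x)"
  using conj_norm_mult[of x "inverse x"] conj_norm_of_rat[of 1]
  by (intro inverse_unique[symmetric]) (simp add: L_inverse)

text \<open>Monogeneity is given at some complex zero, which may be nonreal; the isomorphism of the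
  conjugate fields carries it over to \<open>\<theta>\<close>.\<close>

lemma monogenic_transfer:
  assumes z: "is_zero (z::complex)" and eq: "int_adjoin z = maximal_order (rat_adjoin z)"
  shows "maximal_order L = int_adjoin \<theta>"
proof (intro equalityI subsetI)
  fix x assume x: "x \<in> maximal_order L"
  then obtain a c d where xe: "x = qcomb \<theta> a c d" by (auto simp: maximal_order_def elim: L_cases)
  then have "algebraic_int (qcomb z a c d)"
    using x algebraic_int_qcomb_transfer[OF zero_theta z] by (simp add: maximal_order_def)
  then have "qcomb z a c d \<in> int_adjoin z"
    unfolding eq maximal_order_def using qcomb_in_rat_adjoin by blast
  then obtain a' c' d' where "qcomb z a c d = zcomb z a' c' d'" unfolding int_adjoin_eq[OF z] by blast
  then have "x = zcomb \<theta> a' c' d'" by (simp add: xe zcomb_eq_qcomb qcomb_eq_iff[OF z])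
  then show "x \<in> int_adjoin \<theta>" unfolding int_adjoin_eq[OF zero_theta] by blast
next
  fix x assume "x \<in> int_adjoin \<theta>"
  then obtain a c d where x: "x = zcomb \<theta> a c d" unfolding int_adjoin_eq[OF zero_theta] by blast
  have "zcomb z a c d \<in> maximal_order (rat_adjoin z)" unfolding eq[symmetric] int_adjoin_eq[OF z] by blast
  then have "algebraic_int x"
    using algebraic_int_qcomb_transfer[OF z zero_theta] by (simp add: maximal_order_def x zcomb_eq_qcomb)
  then show "x \<in> maximal_order L" unfolding maximal_order_def using x zcomb_in_L by blast
qed

section \<open>No new cube roots of rational numbers\<close>

text \<open>Let \<open>x ^ 3\<close> be rational with x irrational, and let y be the conjugate of x at \<open>\<omega>\<close>.
  Then \<open>y ^ 3 = x ^ 3\<close> with \<open>y \<noteq> x\<close>, so \<open>y\<^sup>2 + x * y + x\<^sup>2 = 0\<close>. The imaginary part says that x has trace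
  0, which determines the coordinate a. Substituting it in the real part leaves a quadratic form
  in c and d whose discriminant is \<open>4 * r ^ 3 * b + 1\<close>.\<close>

lemma cube_rational_imp_quadratic:
  assumes "x = qcomb \<theta> a c d" "x ^ 3 \<in> \<rat>"
  shows "of_nat r ^ 2 * of_int b * d\<^sup>2 + c * d - of_nat r * c\<^sup>2 = 0"
proof (cases "c = 0 \<and> d = 0")
  case False
  define A C D where ACD: "A = real_of_rat a" "C = real_of_rat c" "D = real_of_rat d"
  define y where "y = qcomb \<omega> a c d"
  define s where "s = Im \<omega>"
  have s2: "s\<^sup>2 = p + 3 * \<theta>\<^sup>2 / 4" and s0: "s > 0" by (simp_all add: s_def Im_omega_sq Im_omega_pos)
  have R: "Re y = A + C * (- \<theta> / 2) + D * (\<theta>\<^sup>2 / 4 - s\<^sup>2)"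
    and I: "Im y = s * (C - D * \<theta>)"
    unfolding qcomb_def ACD s_def y_def
    by (simp_all add: Re_omega Re_power2 Im_power2 power_divide algebra_simps flip: of_real_of_rat)
  have x: "x = A + C * \<theta> + D * \<theta>\<^sup>2" unfolding assms qcomb_def ACD by simp
  have xL: "x \<in> L" using assms qcomb_in_rat_adjoin by simp
  obtain q where q: "x ^ 3 = of_rat q" using assms(2) by (auto elim: Rats_cases)
  have "emb \<omega> (x * (x * x)) = y * (y * y)"
    using assms(1) xL by (simp add: emb_mult L_mult zero_omega y_def emb_qcomb)
  moreover have "x * (x * x) = of_rat q" using q by (simp add: power3_eq_cube)
  ultimately have "y * (y * y) = of_rat q" by (simp add: emb_of_rat)
  then have y3: "y ^ 3 = of_real (x ^ 3)" using q by (simp add: power3_eq_cube mult.assoc flip: of_real_of_rat)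
  have Iy: "Im y \<noteq> 0"
  proof
    assume "Im y = 0"
    then have "qcomb \<theta> (- c) d 0 = 0" using s0 I by (simp add: qcomb_def ACD of_rat_minus)
    then show False using False qcomb_eq_0_iff[OF zero_theta] by simp
  qed
  have "(y - of_real x) * (y\<^sup>2 + of_real x * y + of_real (x\<^sup>2)) = y ^ 3 - of_real (x ^ 3)"
    by (simp add: algebra_simps power2_eq_square power3_eq_cube)
  moreover have "y - of_real x \<noteq> 0" using Iy by (auto simp: complex_eq_iff)
  ultimately have q0: "y\<^sup>2 + of_real x * y + of_real (x\<^sup>2) = 0" using y3 by simp
  from arg_cong[OF q0, of Im] have "Im y * (2 * Re y + x) = 0"
    by (simp add: Im_power2 algebra_simps)
  then have e1: "2 * Re y + x = 0" using Iy by simp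
  from arg_cong[OF q0, of Re] have e2: "(Re y)\<^sup>2 - (Im y)\<^sup>2 + x * Re y + x\<^sup>2 = 0"
    by (simp add: Re_power2)
  have "x = - 2 * Re y" using e1 by simp
  then have e2': "3 * (Re y)\<^sup>2 = (Im y)\<^sup>2" using e2 by (simp add: power2_eq_square)
  have A: "3 * A = 2 * D * p"
    using e1 unfolding R s2 x by (simp add: field_simps power2_eq_square)
  have Re6: "6 * Re y = - 3 * C * \<theta> - 2 * D * p - 3 * D * \<theta>\<^sup>2"
    using A unfolding R s2 by (simp add: field_simps power2_eq_square)
  have "(- 3 * C * \<theta> - 2 * D * p - 3 * D * \<theta>\<^sup>2)\<^sup>2 = 12 * (3 * (Re y)\<^sup>2)"
    unfolding Re6[symmetric] by (simp add: power_mult_distrib)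
  also have "\<dots> = 12 * (p + 3 * \<theta>\<^sup>2 / 4) * (C - D * \<theta>)\<^sup>2"
    unfolding e2' I power_mult_distrib s2 by simp
  finally have e3: "(- 3 * C * \<theta> - 2 * D * p - 3 * D * \<theta>\<^sup>2)\<^sup>2 = (12 * p + 9 * \<theta>\<^sup>2) * (C - D * \<theta>)\<^sup>2"
    by (simp add: algebra_simps)
  have "(- 3 * C * \<theta> - 2 * D * p - 3 * D * \<theta>\<^sup>2)\<^sup>2 - (12 * p + 9 * \<theta>\<^sup>2) * (C - D * \<theta>)\<^sup>2
    = 4 * p\<^sup>2 * D\<^sup>2 - 12 * p * C\<^sup>2 + 36 * C * D * (\<theta> ^ 3 + p * \<theta>)"
    by (simp add: algebra_simps power2_eq_square power3_eq_cube)
  then have "4 * p\<^sup>2 * D\<^sup>2 - 12 * p * C\<^sup>2 + 36 * C * D * of_int b = 0"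
    using e3 theta_cubed by simp
  then have "(36 * of_int b) * (real r ^ 2 * of_int b * D\<^sup>2 + C * D - real r * C\<^sup>2) = 0"
    by (simp add: algebra_simps power2_eq_square)
  then have "real r ^ 2 * of_int b * D\<^sup>2 + C * D - real r * C\<^sup>2 = 0" using b_ge_2 by simp
  then have "real_of_rat (of_nat r ^ 2 * of_int b * d\<^sup>2 + c * d - of_nat r * c\<^sup>2) = 0"
    by (simp add: ACD of_rat_add of_rat_diff of_rat_mult of_rat_power)
  then show ?thesis by (simp only: of_rat_eq_0_iff)
qed simp

end

locale monogenic_trinomial_field = trinomial_field +
  assumes monogen: "maximal_order L = int_adjoin \<theta>"
begin

lemma order_eq: "maximal_order L = {zcomb \<theta> a c d | a c d. True}"
  using monogen int_adjoin_eq[OF zero_theta] by simp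

lemma order_cases:
  assumes "x \<in> maximal_order L" obtains a c d where "x = zcomb \<theta> a c d"
  using assms order_eq by blast

lemma zcomb_in_order [intro]: "zcomb \<theta> a c d \<in> maximal_order L"
  using order_eq by blast

lemma qcomb_in_order_iff:
  "qcomb \<theta> a c d \<in> maximal_order L \<longleftrightarrow> a \<in> \<int> \<and> c \<in> \<int> \<and> d \<in> \<int>"
proof
  assume "qcomb \<theta> a c d \<in> maximal_order L"
  then obtain a' c' d' where "qcomb \<theta> a c d = zcomb \<theta> a' c' d'" by (rule order_cases)
  then show "a \<in> \<int> \<and> c \<in> \<int> \<and> d \<in> \<int>" by (auto simp: zcomb_eq_qcomb qcomb_eq_iff[OF zero_theta])
next
  assume "a \<in> \<int> \<and> c \<in> \<int> \<and> d \<in> \<int>"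
  then obtain a' c' d' where "a = of_int a'" "c = of_int c'" "d = of_int d'" by (auto elim!: Ints_cases)
  then show "qcomb \<theta> a c d \<in> maximal_order L" by (simp flip: zcomb_eq_qcomb add: zcomb_in_order)
qed

lemma order_in_L: "x \<in> maximal_order L \<Longrightarrow> x \<in> L"
  by (simp add: maximal_order_def)

lemma order_mult: "x \<in> maximal_order L \<Longrightarrow> y \<in> maximal_order L \<Longrightarrow> x * y \<in> maximal_order L"
  by (elim order_cases) (metis zcomb_mult_closed[OF zero_theta] zcomb_in_order)

lemma order_of_int: "of_int n \<in> maximal_order L"
  by (metis of_int_eq_zcomb zcomb_in_order)

lemma order_1: "1 \<in> maximal_order L" using order_of_int[of 1] by simp

lemma theta_in_order: "\<theta> \<in> maximal_order L"
  by (metis theta_eq_zcomb zcomb_in_order)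

text \<open>Suppose \<open>4 * r ^ 3 * b + 1 = m\<^sup>2\<close>. With \<open>k = - 2 * r\<^sup>2 * b\<close> one has
  \<open>2 * r * k = 1 - m\<^sup>2\<close>, and modulo \<open>m\<^sup>2\<close> the polynomial is \<open>(X - k)\<^sup>2 * (X + 2 * k)\<close>. Therefore
  \<open>x = (\<theta> - k) * (\<theta> + 2 * k) / m\<close> has its square in \<open>\<int>[\<theta>]\<close>: the numerator squared is
  \<open>(\<theta> - k)\<^sup>2 * (\<theta> + 2 * k)\<close> times \<open>\<theta> + 2 * k\<close>, and the first factor is a multiple of \<open>m\<^sup>2\<close>. So x
  is integral, although its leading coordinate is \<open>1 / m\<close>.\<close>

lemma discriminant_factor_not_square:
  "4 * int r ^ 3 * b + 1 \<noteq> m\<^sup>2"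
proof
  assume m: "4 * int r ^ 3 * b + 1 = m\<^sup>2"
  have "4 * int r ^ 3 * b \<ge> 4 * 1 * 2"
    using r_pos b_ge_2 by (intro mult_mono) auto
  then have m2: "m\<^sup>2 > 1" using m by linarith
  then have m0: "m \<noteq> 0" and mu: "\<not> m dvd 1" by (auto simp: abs_square_eq_1[symmetric] zdvd1_eq)
  define R B M where RBM: "R = real r" "B = real_of_int b" "M = real_of_int m"
  have M: "M\<^sup>2 = 4 * R ^ 3 * B + 1" and M0: "M \<noteq> 0"
    using arg_cong[OF m, of real_of_int] m0 by (simp_all add: RBM)
  have t3: "\<theta> ^ 3 = B - 3 * R * B * \<theta>" using theta_cubed by (simp add: RBM)
  have t4: "\<theta> ^ 4 = B * \<theta> - 3 * R * B * \<theta>\<^sup>2"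
    using arg_cong[OF t3, of "\<lambda>x. x * \<theta>"] by (simp add: algebra_simps power2_eq_square power_numeral_reduce)
  \<comment> \<open>In the notation above \<open>k = - 2 * r\<^sup>2 * b\<close>, so \<open>2 * k\<^sup>2 = 8 * r ^ 4 * b\<^sup>2\<close>.\<close>
  define x where "x = qcomb \<theta> (- 8 * of_nat r ^ 4 * of_int b ^ 2 / of_int m) (- 2 * of_nat r ^ 2 * of_int b / of_int m) (1 / of_int m)"
  have x: "x = (\<theta>\<^sup>2 - 2 * R\<^sup>2 * B * \<theta> - 8 * R ^ 4 * B\<^sup>2) / M"
    unfolding x_def qcomb_def RBM
    by (simp add: of_rat_divide of_rat_mult of_rat_power of_rat_minus diff_divide_distrib)
  have "(\<theta>\<^sup>2 - 2 * R\<^sup>2 * B * \<theta> - 8 * R ^ 4 * B\<^sup>2)\<^sup>2 = M\<^sup>2 * - ((\<theta> - 4 * R\<^sup>2 * B) * (3 * R * B * \<theta> + 4 * R ^ 3 * B\<^sup>2 - B))"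
  proof -
    have "(\<theta>\<^sup>2 - 2 * R\<^sup>2 * B * \<theta> - 8 * R ^ 4 * B\<^sup>2)\<^sup>2 =
      \<theta> ^ 4 - 4 * R\<^sup>2 * B * \<theta> ^ 3 + (4 * R ^ 4 * B\<^sup>2 - 16 * R ^ 4 * B\<^sup>2) * \<theta>\<^sup>2 + 32 * R ^ 6 * B ^ 3 * \<theta> + 64 * R ^ 8 * B ^ 4"
      by (simp add: algebra_simps power2_eq_square power3_eq_cube power_numeral_reduce)
    then show ?thesis unfolding M t3 t4
      by (simp add: algebra_simps power2_eq_square power3_eq_cube power_numeral_reduce)
  qed
  then have x2: "x\<^sup>2 = - ((\<theta> - 4 * R\<^sup>2 * B) * (3 * R * B * \<theta> + 4 * R ^ 3 * B\<^sup>2 - B))"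
    using M0 by (simp add: x power_divide)
  also have "\<dots> = zcomb \<theta> (- (4 * (int r)\<^sup>2 * b)) 1 0 * zcomb \<theta> (b - 4 * int r ^ 3 * b\<^sup>2) (- 3 * int r * b) 0"
    by (simp add: zcomb_def RBM algebra_simps)
  also have "\<dots> \<in> maximal_order L" by (intro order_mult zcomb_in_order)
  finally have "algebraic_int (x\<^sup>2)" by (simp add: maximal_order_def)
  then have "algebraic_int x"
    by (rule algebraic_int_root[of _ "[:0,0,1:]"]) (auto simp: power2_eq_square coeff_pCons split: nat.splits)
  then have "x \<in> maximal_order L" unfolding maximal_order_def x_def using qcomb_in_rat_adjoin by blast
  then have "1 / of_int m \<in> (\<int> :: rat set)" unfolding x_def qcomb_in_order_iff by blast
  then obtain k where "1 / of_int m = (of_int k :: rat)" by (auto elim: Ints_cases)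
  then have "of_int (m * k) = (of_int 1 :: rat)" using m0 by (simp add: field_simps)
  then have "m * k = 1" by (simp only: of_int_eq_iff)
  then show False using mu by (metis dvd_triv_left)
qed

text \<open>A nontrivial rational solution of the quadratic equation makes its discriminant
  \<open>4 * r ^ 3 * b + 1\<close> a rational square.\<close>

theorem cube_rational_imp_rational:
  assumes x: "x \<in> L" and "x ^ 3 \<in> \<rat>"
  shows "x \<in> \<rat>"
proof -
  obtain a c d where acd: "x = qcomb \<theta> a c d" using x by (rule L_cases)
  have q: "of_nat r ^ 2 * of_int b * d\<^sup>2 + c * d - of_nat r * c\<^sup>2 = 0"
    using cube_rational_imp_quadratic[OF acd assms(2)] .
  have d0: "d = 0"
  proof (rule ccontr)
    assume d: "d \<noteq> 0"
    \<comment> \<open>Completing the square in c.\<close>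
    define u where "u = (2 * of_nat r * c - d) / d"
    have "(2 * of_nat r * c - d)\<^sup>2 = 4 * of_nat r * (of_nat r * c\<^sup>2 - c * d) + d\<^sup>2"
      by (simp add: algebra_simps power2_eq_square)
    also have "of_nat r * c\<^sup>2 - c * d = of_nat r ^ 2 * of_int b * d\<^sup>2" using q by simp
    finally have "(2 * of_nat r * c - d)\<^sup>2 = d\<^sup>2 * (4 * of_nat r ^ 3 * of_int b + 1)"
      by (simp add: algebra_simps power2_eq_square power3_eq_cube)
    then have "u\<^sup>2 = of_int (4 * int r ^ 3 * b + 1)"
      using d by (simp add: u_def power_divide)
    then show False using square_rat_imp_square_int discriminant_factor_not_square by metis
  qed
  then have "c = 0" using q r_pos by simp
  then show ?thesis using d0 acd by (simp add: qcomb_def)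
qed

end

section \<open>Discriminants\<close>

text \<open>Laplace expansion along the first column, stated for lists of rows so that the simplifier can
  evaluate explicit determinants recursively.\<close>

lemma det_rows_expand:
  fixes rows :: "'a::comm_ring_1 list list"
  assumes "length rows = Suc n" "\<forall>row\<in>set rows. length row = Suc n"
  shows "det (mat (Suc n) (Suc n) (\<lambda>(i, j). rows ! i ! j)) = (\<Sum>i<Suc n. rows ! i ! 0 * ((-1) ^ i *
    det (mat n n (\<lambda>(k, l). map tl (take i rows @ drop (Suc i) rows) ! k ! l))))"
proof -
  define A where "A = mat (Suc n) (Suc n) (\<lambda>(i, j). rows ! i ! j)"
  have del: "mat_delete A i 0 = mat n n (\<lambda>(k, l). map tl (take i rows @ drop (Suc i) rows) ! k ! l)"
    if "i < Suc n" for i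
  proof (rule eq_matI)
    fix k l assume "k < dim_row (mat n n (\<lambda>(k, l). map tl (take i rows @ drop (Suc i) rows) ! k ! l))"
      "l < dim_col (mat n n (\<lambda>(k, l). map tl (take i rows @ drop (Suc i) rows) ! k ! l))"
    then have kl: "k < n" "l < n" by auto
    define k' where "k' = (if k < i then k else Suc k)"
    have "(take i rows @ drop (Suc i) rows) ! k = rows ! k'"
      using kl that assms(1) by (auto simp: k'_def nth_append)
    then have "map tl (take i rows @ drop (Suc i) rows) ! k = tl (rows ! k')"
      using kl that assms(1) by (subst nth_map) auto
    moreover have "length (rows ! k') = Suc n" using kl assms by (auto simp: k'_def)
    ultimately show "mat_delete A i 0 $$ (k, l) = mat n n (\<lambda>(k, l). map tl (take i rows @ drop (Suc i) rows) ! k ! l) $$ (k, l)"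
      using kl that assms(1) by (auto simp: A_def mat_delete_def k'_def nth_tl simp del: map_append)
  qed (auto simp: A_def mat_delete_def)
  have "det A = (\<Sum>i<Suc n. A $$ (i, 0) * cofactor A i 0)"
    by (rule laplace_expansion_column) (auto simp: A_def)
  also have "\<dots> = (\<Sum>i<Suc n. rows ! i ! 0 * ((-1) ^ i *
    det (mat n n (\<lambda>(k, l). map tl (take i rows @ drop (Suc i) rows) ! k ! l))))"
    by (intro sum.cong refl) (simp add: cofactor_def del, simp add: A_def)
  finally show ?thesis unfolding A_def .
qed

lemma det_mat_3:
  fixes f :: "nat \<Rightarrow> nat \<Rightarrow> 'a::comm_ring_1"
  shows "det (mat 3 3 (\<lambda>(i, j). f i j)) =
    f 0 0 * (f 1 1 * f 2 2 - f 2 1 * f 1 2) - f 1 0 * (f 0 1 * f 2 2 - f 2 1 * f 0 2)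
    + f 2 0 * (f 0 1 * f 1 2 - f 1 1 * f 0 2)"
proof -
  have "mat 3 3 (\<lambda>(i, j). f i j) = mat (Suc (Suc (Suc 0))) (Suc (Suc (Suc 0)))
    (\<lambda>(i, j). [[f 0 0, f 0 1, f 0 2], [f 1 0, f 1 1, f 1 2], [f 2 0, f 2 1, f 2 2]] ! i ! j)"
    by (rule eq_matI) (auto simp: less_Suc_eq numeral_3_eq_3 numeral_2_eq_2)
  then show ?thesis by (simp add: det_rows_expand lessThan_Suc algebra_simps)
qed

lemma poly_discriminant_depressed_cubic:
  "poly_discriminant [:q, p, 0, 1:] = - 4 * p ^ 3 - 27 * q\<^sup>2"
proof -
  have pd: "pderiv [:q, p, 0, 1:] = [:p, 0, 3:]" by (simp add: pderiv_pCons)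
  have "sylvester_mat [:q, p, 0, 1:] [:p, 0, 3:] = mat (Suc (Suc (Suc (Suc (Suc 0))))) (Suc (Suc (Suc (Suc (Suc 0)))))
    (\<lambda>(i, j). [[1,0,p,q,0],[0,1,0,p,q],[3,0,p,0,0],[0,3,0,p,0],[0,0,3,0,p]] ! i ! j)" (is "?S = ?M")
  proof (rule eq_matI)
    fix i j assume "i < dim_row ?M" "j < dim_col ?M"
    then have "i \<in> {0, 1, 2, 3, 4}" "j \<in> {0, 1, 2, 3, 4}" by auto
    then show "?S $$ (i, j) = ?M $$ (i, j)"
      by (elim insertE emptyE; simp add: sylvester_mat_def sylvester_mat_sub_def numeral_eq_Suc)
  qed (simp_all add: sylvester_mat_def sylvester_mat_sub_def)
  then have "resultant [:q, p, 0, 1:] [:p, 0, 3:] = det ?M" by (simp add: resultant_def)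
  also have "\<dots> = 4 * p ^ 3 + 27 * q\<^sup>2"
    by (simp add: det_rows_expand lessThan_Suc algebra_simps power2_eq_square power3_eq_cube)
  finally show ?thesis by (simp add: poly_discriminant_def pd)
qed

text \<open>The equations of three distinct zeros, subtracted from each other, give
  Vieta's relations \<open>z 0 + z 1 + z 2 = 0\<close> and expressions for p and q in \<open>z 0\<close> and \<open>z 1\<close>, after which
  the claim is a polynomial identity. The result does not depend on the order of the zeros.\<close>

lemma vandermonde_depressed_cubic:
  fixes z :: "nat \<Rightarrow> 'a::{idom, ring_char_0}"
  assumes z: "\<And>i. i < 3 \<Longrightarrow> z i ^ 3 + p * z i + q = 0" and inj: "inj_on z {..<3}"
  shows "(det (mat 3 3 (\<lambda>(i, j). z i ^ j)))\<^sup>2 = - 4 * p ^ 3 - 27 * q\<^sup>2"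
proof -
  have ne: "z 0 \<noteq> z 1" "z 0 \<noteq> z 2" "z 1 \<noteq> z 2"
    using inj_onD[OF inj, of 0 1] inj_onD[OF inj, of 0 2] inj_onD[OF inj, of 1 2] by auto
  have quad: "x\<^sup>2 + x * y + y\<^sup>2 + p = 0" if "x ^ 3 + p * x + q = 0" "y ^ 3 + p * y + q = 0" "x \<noteq> y" for x y
  proof -
    have "(x - y) * (x\<^sup>2 + x * y + y\<^sup>2 + p) = (x ^ 3 + p * x + q) - (y ^ 3 + p * y + q)"
      by (simp add: algebra_simps power2_eq_square power3_eq_cube)
    then show ?thesis using that by simp
  qed
  have q01: "(z 0)\<^sup>2 + z 0 * z 1 + (z 1)\<^sup>2 + p = 0" and q02: "(z 0)\<^sup>2 + z 0 * z 2 + (z 2)\<^sup>2 + p = 0"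
    using z ne by (auto intro!: quad)
  have "(z 1 - z 2) * (z 0 + z 1 + z 2) = ((z 0)\<^sup>2 + z 0 * z 1 + (z 1)\<^sup>2 + p) - ((z 0)\<^sup>2 + z 0 * z 2 + (z 2)\<^sup>2 + p)"
    by (simp add: algebra_simps power2_eq_square)
  then have "z 0 + z 1 + z 2 = 0" using q01 q02 ne by simp
  then have z2: "z 2 = - z 0 - z 1" by (simp add: eq_neg_iff_add_eq_0 algebra_simps)
  have p: "p = - ((z 0)\<^sup>2 + z 0 * z 1 + (z 1)\<^sup>2)" using q01 by (simp add: eq_neg_iff_add_eq_0 algebra_simps)
  have "q = - (z 0 ^ 3 + p * z 0)" using z[of 0] by (simp add: eq_neg_iff_add_eq_0 algebra_simps)
  then have q: "q = z 0 * z 1 * (z 0 + z 1)" unfolding p by (simp add: algebra_simps power2_eq_square power3_eq_cube)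
  have "det (mat 3 3 (\<lambda>(i, j). z i ^ j)) = (z 1 - z 0) * ((z 2 - z 0) * (z 2 - z 1))"
    unfolding det_mat_3 by (simp add: algebra_simps power2_eq_square)
  also have "\<dots> = (z 1 - z 0) * ((2 * z 0 + z 1) * (z 0 + 2 * z 1))" unfolding z2 by (simp add: algebra_simps)
  finally have d: "det (mat 3 3 (\<lambda>(i, j). z i ^ j)) = (z 1 - z 0) * ((2 * z 0 + z 1) * (z 0 + 2 * z 1))" .
  show ?thesis unfolding d p q by (simp add: algebra_simps power2_eq_square power3_eq_cube)
qed

context trinomial_field
begin

lemma rat_degree_L: "rat_degree L = 3"
proof -
  interpret Q: vector_space "\<lambda>(q::rat) (x::real). of_rat q * x"
    by unfold_locales (simp_all add: of_rat_add of_rat_mult algebra_simps)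
  have qcomb: "qcomb \<theta> a c d = of_rat a * 1 + of_rat c * \<theta> + of_rat d * \<theta>\<^sup>2" for a c d by (simp add: qcomb_def)
  have ne: "1 \<noteq> \<theta>" "1 \<noteq> \<theta>\<^sup>2" "\<theta> \<noteq> \<theta>\<^sup>2"
    using qcomb_eq_iff[OF zero_theta, of 1 0 0 0 1 0] qcomb_eq_iff[OF zero_theta, of 1 0 0 0 0 1]
      qcomb_eq_iff[OF zero_theta, of 0 1 0 0 0 1] by (simp_all add: qcomb_def)
  have "Q.dim L = 3"
  proof (rule Q.dim_unique[of "{1, \<theta>, \<theta>\<^sup>2}"])
    have "1 = qcomb \<theta> 1 0 0" "\<theta> = qcomb \<theta> 0 1 0" "\<theta>\<^sup>2 = qcomb \<theta> 0 0 1" by (simp_all add: qcomb_def)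
    then show "{1, \<theta>, \<theta>\<^sup>2} \<subseteq> L" using qcomb_in_rat_adjoin[of \<theta>] by (metis empty_subsetI insert_subset)
    show "L \<subseteq> Q.span {1, \<theta>, \<theta>\<^sup>2}"
    proof
      fix x assume "x \<in> L"
      then obtain a c d where "x = qcomb \<theta> a c d" by (rule L_cases)
      moreover have "1 \<in> Q.span {1, \<theta>, \<theta>\<^sup>2}" "\<theta> \<in> Q.span {1, \<theta>, \<theta>\<^sup>2}" "\<theta>\<^sup>2 \<in> Q.span {1, \<theta>, \<theta>\<^sup>2}"
        by (simp_all add: Q.span_base)
      ultimately show "x \<in> Q.span {1, \<theta>, \<theta>\<^sup>2}" unfolding qcomb by (blast intro: Q.span_add Q.span_scale)
    qed
    show "Q.independent {1, \<theta>, \<theta>\<^sup>2}"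
    proof
      assume "Q.dependent {1, \<theta>, \<theta>\<^sup>2}"
      then obtain u where u: "\<exists>v\<in>{1, \<theta>, \<theta>\<^sup>2}. u v \<noteq> 0" "(\<Sum>v\<in>{1, \<theta>, \<theta>\<^sup>2}. of_rat (u v) * v) = 0"
        by (auto simp: Q.dependent_finite simp del: sum.insert)
      then have "qcomb \<theta> (u 1) (u \<theta>) (u (\<theta>\<^sup>2)) = 0" using ne by (simp add: qcomb_def add.assoc)
      then show False using u(1) by (simp add: qcomb_eq_0_iff[OF zero_theta])
    qed
    show "card {1, \<theta>, \<theta>\<^sup>2} = 3" using ne by simp
  qed
  then show ?thesis by (simp add: rat_degree_def)
qed

lemma simply_real_cubic_L: "simply_real_cubic L"
  by (simp add: simply_real_cubic_def subfield_L rat_degree_L real_embeddings_eq)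

text \<open>Integral bases are given by indexed sums; this passes to the coordinates used elsewhere.\<close>

lemma sum_powers_eq_zcomb: "(\<Sum>k<3. of_int (c k) * t ^ k) = zcomb t (c 0) (c 1) (c 2)"
  by (simp add: zcomb_def numeral_eq_Suc lessThan_Suc)

lemma emb_sum_powers: "emb z (\<Sum>k<3. of_int (c k) * \<theta> ^ k) = (\<Sum>k<3. of_int (c k) * z ^ k)"
  by (simp add: sum_powers_eq_zcomb zcomb_eq_qcomb emb_qcomb)

lemma sum_powers_cong:
  assumes "(\<Sum>k<3. of_int (c k) * \<theta> ^ k) = (\<Sum>k<3. of_int (c' k) * \<theta> ^ k)" "k < 3"
  shows "c k = c' k"
proof -
  have "c 0 = c' 0" "c 1 = c' 1" "c 2 = c' 2"
    using assms(1) unfolding sum_powers_eq_zcomb zcomb_eq_qcomb qcomb_eq_iff[OF zero_theta] by simp_all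
  moreover have "k = 0 \<or> k = 1 \<or> k = 2" using assms(2) by auto
  ultimately show ?thesis by auto
qed

end

context monogenic_trinomial_field
begin

lemma order_sum_powers:
  assumes "x \<in> maximal_order L"
  obtains c where "x = (\<Sum>k<3. of_int (c k) * \<theta> ^ k)"
proof -
  obtain a c d where "x = zcomb \<theta> a c d" using assms by (rule order_cases)
  then have "x = (\<Sum>k<3. of_int ((\<lambda>k. if k = 0 then a else if k = 1 then c else d) k) * \<theta> ^ k)"
    by (simp add: sum_powers_eq_zcomb)
  then show thesis by (rule that)
qed

lemma integral_basis_powers: "integral_basis L 3 (\<lambda>i. \<theta> ^ i)"
  unfolding integral_basis_def
proof (intro conjI allI impI ballI)
  show "\<theta> ^ i \<in> maximal_order L" for i
    by (induction i) (auto intro: order_1 order_mult theta_in_order)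
  fix x assume "x \<in> maximal_order L"
  then obtain c where c: "x = (\<Sum>k<3. of_int (c k) * \<theta> ^ k)" by (rule order_sum_powers)
  show "\<exists>!c :: nat \<Rightarrow> int. c \<in> extensional {..<3} \<and> x = (\<Sum>i<3. of_int (c i) * \<theta> ^ i)"
  proof (rule ex1I[of _ "restrict c {..<3}"])
    show "restrict c {..<3} \<in> extensional {..<3} \<and> x = (\<Sum>i<3. of_int (restrict c {..<3} i) * \<theta> ^ i)"
      unfolding c by (auto intro!: sum.cong)
    fix c' assume c': "c' \<in> extensional {..<3} \<and> x = (\<Sum>i<3. of_int (c' i) * \<theta> ^ i)"
    show "c' = restrict c {..<3}"
    proof (rule extensionalityI[of _ "{..<3}"])
      show "c' k = restrict c {..<3} k" if "k \<in> {..<3}" for k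
        using sum_powers_cong[of c' c k] c' c that by simp
    qed (use c' in auto)
  qed
qed

text \<open>Any integral basis and the powers of \<open>\<theta>\<close> are expressed through each other by integral
  matrices, which are inverse to each other. So the determinant of the transition has square 1, and
  the determinant of the conjugates can be computed for the powers of \<open>\<theta>\<close>, where it is a
  Vandermonde determinant.\<close>

lemma integral_basis_det_sq:
  assumes basis: "integral_basis L 3 \<beta>" and \<sigma>: "bij_betw \<sigma> {..<3} (embeddings L)"
  shows "(det (mat 3 3 (\<lambda>(i, j). \<sigma> i (\<beta> j))))\<^sup>2 = of_int (- 27 * b\<^sup>2 * (4 * int r ^ 3 * b + 1))"
proof -
  have in_order: "\<beta> j \<in> maximal_order L" if "j < 3" for j
    using basis that by (simp add: integral_basis_def)
  have "\<forall>j\<in>{..<3}. \<exists>c :: nat \<Rightarrow> int. \<beta> j = (\<Sum>k<3. of_int (c k) * \<theta> ^ k)"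
    using in_order order_sum_powers by (metis lessThan_iff)
  then obtain C :: "nat \<Rightarrow> nat \<Rightarrow> int" where C: "\<And>j. j < 3 \<Longrightarrow> \<beta> j = (\<Sum>k<3. of_int (C j k) * \<theta> ^ k)"
    by (metis lessThan_iff)
  have "\<theta> ^ k \<in> maximal_order L" if "k < 3" for k
    using integral_basis_powers that by (simp add: integral_basis_def)
  then have "\<forall>k\<in>{..<3}. \<exists>c :: nat \<Rightarrow> int. \<theta> ^ k = (\<Sum>j<3. of_int (c j) * \<beta> j)"
    using basis unfolding integral_basis_def by (metis lessThan_iff)
  then obtain E :: "nat \<Rightarrow> nat \<Rightarrow> int" where E: "\<And>k. k < 3 \<Longrightarrow> \<theta> ^ k = (\<Sum>j<3. of_int (E k j) * \<beta> j)"
    by (metis lessThan_iff)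
  define MC where "MC = mat 3 3 (\<lambda>(k, j). C j k)"
  define ME where "ME = mat 3 3 (\<lambda>(j, k). E k j)"
  have car: "MC \<in> carrier_mat 3 3" "ME \<in> carrier_mat 3 3" by (auto simp: MC_def ME_def)
  have "MC * ME = 1\<^sub>m 3"
  proof (rule eq_matI)
    fix l k assume "l < dim_row (1\<^sub>m 3 :: int mat)" "k < dim_col (1\<^sub>m 3 :: int mat)"
    then have lk: "l < 3" "k < 3" by auto
    have "(\<Sum>l<3. of_int (if l = k then 1 else 0) * \<theta> ^ l) = \<theta> ^ k"
      using lk by (simp add: if_distrib[of of_int] if_distrib[of "\<lambda>x. x * _"] cong: if_cong)
    also have "\<dots> = (\<Sum>j<3. \<Sum>l<3. of_int (E k j) * (of_int (C j l) * \<theta> ^ l))"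
      using E[OF lk(2)] by (simp add: C sum_distrib_left)
    also have "\<dots> = (\<Sum>l<3. of_int (\<Sum>j<3. C j l * E k j) * \<theta> ^ l)"
      by (subst sum.swap) (simp add: sum_distrib_left sum_distrib_right mult_ac)
    finally have "(if l = k then 1 else 0) = (\<Sum>j<3. C j l * E k j)"
      by (rule sum_powers_cong[OF _ lk(1)])
    then show "(MC * ME) $$ (l, k) = (1\<^sub>m 3) $$ (l, k)"
      using lk by (auto simp: MC_def ME_def scalar_prod_def atLeast0LessThan)
  qed (use car in auto)
  then have "det MC * det ME = 1" using det_mult[OF car] by simp
  then have dC: "(det MC)\<^sup>2 = 1" by (auto simp: zmult_eq_1_iff)
  define z where "z i = \<sigma> i \<theta>" for i
  have sig: "is_zero (z i) \<and> \<sigma> i = emb (z i)" if "i < 3" for i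
  proof -
    have "\<sigma> i \<in> embeddings L" using \<sigma> that by (auto simp: bij_betw_def)
    then obtain y where "\<sigma> i = emb y" "is_zero y" unfolding embeddings_eq using complex_zero_iff by blast
    then show ?thesis by (simp add: z_def emb_theta)
  qed
  have "inj_on z {..<3}"
    using \<sigma> sig by (auto simp: bij_betw_def inj_on_def)
  then have V: "(det (mat 3 3 (\<lambda>(i, j). z i ^ j)))\<^sup>2 = - 4 * (3 * of_nat r * of_int b) ^ 3 - 27 * (- of_int b)\<^sup>2"
    using sig by (intro vandermonde_depressed_cubic) (auto simp: is_zero_def)
  have "mat 3 3 (\<lambda>(i, j). \<sigma> i (\<beta> j)) = mat 3 3 (\<lambda>(i, j). z i ^ j) * map_mat of_int MC"
  proof (rule eq_matI)
    fix i j assume "i < dim_row (mat 3 3 (\<lambda>(i, j). z i ^ j) * map_mat of_int MC)"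
      "j < dim_col (mat 3 3 (\<lambda>(i, j). z i ^ j) * map_mat of_int MC)"
    then have ij: "i < 3" "j < 3" by (auto simp: MC_def)
    then have "\<sigma> i (\<beta> j) = (\<Sum>k<3. of_int (C j k) * z i ^ k)"
      using sig by (simp add: C emb_sum_powers)
    then show "mat 3 3 (\<lambda>(i, j). \<sigma> i (\<beta> j)) $$ (i, j) = (mat 3 3 (\<lambda>(i, j). z i ^ j) * map_mat of_int MC) $$ (i, j)"
      using ij by (simp add: MC_def scalar_prod_def atLeast0LessThan mult.commute)
  qed (auto simp: MC_def)
  then have "det (mat 3 3 (\<lambda>(i, j). \<sigma> i (\<beta> j))) = det (mat 3 3 (\<lambda>(i, j). z i ^ j)) * of_int (det MC)"
    using car by (simp add: det_mult[of _ 3] flip: of_int_hom.hom_det)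
  then have sq: "(det (mat 3 3 (\<lambda>(i, j). \<sigma> i (\<beta> j))))\<^sup>2 = (det (mat 3 3 (\<lambda>(i, j). z i ^ j)))\<^sup>2 * of_int ((det MC)\<^sup>2)"
    by (simp add: power_mult_distrib)
  show ?thesis unfolding sq V dC by (simp add: algebra_simps power2_eq_square power3_eq_cube)
qed

lemma field_discriminant_L: "field_discriminant L = - 27 * b\<^sup>2 * (4 * int r ^ 3 * b + 1)"
  unfolding field_discriminant_def Let_def rat_degree_L
proof (rule the_equality)
  have "finite (embeddings L)" "card (embeddings L) = 3"
    using complex_zeros_distinct by (simp_all add: embeddings_eq inj_eq[OF inj_emb])
  then obtain \<sigma> where s: "bij_betw \<sigma> {..<3::nat} (embeddings L)"
    using ex_bij_betw_nat_finite[of "embeddings L"] by (auto simp: atLeast0LessThan)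
  show "\<exists>\<omega> \<sigma>. integral_basis L 3 \<omega> \<and> bij_betw \<sigma> {..<3} (embeddings L) \<and>
    of_int (- 27 * b\<^sup>2 * (4 * int r ^ 3 * b + 1)) = (det (mat 3 3 (\<lambda>(i, j). \<sigma> i (\<omega> j))))\<^sup>2"
    using integral_basis_det_sq[OF integral_basis_powers s] integral_basis_powers s by metis
next
  fix D assume "\<exists>\<omega> \<sigma>. integral_basis L 3 \<omega> \<and> bij_betw \<sigma> {..<3} (embeddings L) \<and>
    of_int D = (det (mat 3 3 (\<lambda>(i, j). \<sigma> i (\<omega> j))))\<^sup>2"
  then have "(of_int D :: complex) = of_int (- 27 * b\<^sup>2 * (4 * int r ^ 3 * b + 1))"
    using integral_basis_det_sq by auto
  then show "D = - 27 * b\<^sup>2 * (4 * int r ^ 3 * b + 1)" unfolding of_int_eq_iff .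
qed

end

section \<open>Discrete sets of lattice minima form a chain\<close>

text \<open>Local finiteness gives every minimum a greatest minimum below it and a least one above it,
  so the successor map is a bijection. Two comparable minima are linked by finitely many successor
  steps, by induction on the number of minima between them.\<close>

lemma discrete_minima_chain:
  fixes K :: "real set"
  defines "S \<equiv> lattice_minima K"
  assumes fin: "\<And>x y. 0 < x \<Longrightarrow> finite (S \<inter> {x..y})"
    and below: "\<And>x. 0 < x \<Longrightarrow> \<exists>y\<in>S. y < x" and above: "\<And>x. \<exists>y\<in>S. x < y"
    and one: "1 \<in> S"
  shows "bij_betw (next_minimum K) S S" and "S = range (voronoi_chain K)"
proof -
  define f where "f = next_minimum K"
  have pos: "x > 0" if "x \<in> S" for x using that by (auto simp: S_def lattice_minima_def)
  have f_eq: "f x = m" if "m \<in> S" "m < x" "\<And>y. y \<in> S \<Longrightarrow> y < x \<Longrightarrow> y \<le> m" for x m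
    unfolding f_def next_minimum_def using that by (intro Greatest_equality) (auto simp: S_def)
  have f: "f x \<in> S \<and> f x < x \<and> (\<forall>y\<in>S. y < x \<longrightarrow> y \<le> f x)" if x: "x \<in> S" for x
  proof -
    obtain y where y: "y \<in> S" "y < x" using below pos x by blast
    define Z where "Z = {z \<in> S. y \<le> z \<and> z < x}"
    have "finite Z" by (rule finite_subset[OF _ fin[OF pos[OF y(1)], of x]]) (auto simp: Z_def)
    moreover have "y \<in> Z" using y by (auto simp: Z_def)
    ultimately have m: "Max Z \<in> Z" "\<And>z. z \<in> Z \<Longrightarrow> z \<le> Max Z" by (auto intro: Max_in)
    have "z \<le> Max Z" if "z \<in> S" "z < x" for z
      using m(2)[of z] m(2)[OF \<open>y \<in> Z\<close>] that by (cases "y \<le> z") (auto simp: Z_def)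
    moreover from this have "f x = Max Z" using m(1) by (intro f_eq) (auto simp: Z_def)
    ultimately show ?thesis using m(1) by (auto simp: Z_def)
  qed
  have inj: "inj_on f S"
  proof (rule inj_onI, rule ccontr)
    fix x y assume "x \<in> S" "y \<in> S" "f x = f y" "x \<noteq> y"
    then show False using f[of x] f[of y] by (cases "x < y") fastforce+
  qed
  have surj: "\<exists>y\<in>S. f y = x" if x: "x \<in> S" for x
  proof -
    obtain y where y: "y \<in> S" "x < y" using above by blast
    define Z where "Z = {z \<in> S. x < z \<and> z \<le> y}"
    have "finite Z" by (rule finite_subset[OF _ fin[OF pos[OF x], of y]]) (auto simp: Z_def)
    moreover have "y \<in> Z" using y by (auto simp: Z_def)
    ultimately have m: "Min Z \<in> Z" "\<And>z. z \<in> Z \<Longrightarrow> Min Z \<le> z" by (auto intro: Min_in)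
    have "f (Min Z) = x"
    proof (rule f_eq[OF x])
      show "x < Min Z" using m(1) by (simp add: Z_def)
      show "z \<le> x" if "z \<in> S" "z < Min Z" for z
        using that m(1) m(2)[of z] by (cases "z \<le> x") (auto simp: Z_def)
    qed
    then show ?thesis using m(1) by (auto simp: Z_def)
  qed
  have bij: "bij_betw f S S" unfolding bij_betw_def using inj f surj by blast
  then show "bij_betw (next_minimum K) S S" by (simp add: f_def)
  define g where "g = inv_into S f"
  have fS: "(f ^^ n) x \<in> S" if "x \<in> S" for n x using f that by (induction n) auto
  have gS: "(g ^^ n) x \<in> S" if "x \<in> S" for n x
    using that inv_into_into[of _ f S] bij unfolding g_def bij_betw_def by (induction n) auto
  have gf: "(g ^^ n) ((f ^^ n) x) = x" if "x \<in> S" for n x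
  proof (induction n)
    case (Suc n)
    have "(g ^^ Suc n) ((f ^^ Suc n) x) = (g ^^ n) (g (f ((f ^^ n) x)))"
      by (simp add: funpow_swap1)
    then show ?case using Suc inj fS[OF that] by (simp add: g_def)
  qed simp
  have reach: "\<exists>n. (f ^^ n) x = y" if "x \<in> S" "y \<in> S" "y \<le> x" for x y
    using that
  proof (induction "card {z \<in> S. y \<le> z \<and> z < x}" arbitrary: x rule: less_induct)
    case less
    show ?case
    proof (cases "x = y")
      case True
      then show ?thesis by (intro exI[of _ 0]) simp
    next
      case False
      then have le: "y \<le> f x" using f less.prems by auto
      have "{z \<in> S. y \<le> z \<and> z < f x} \<subset> {z \<in> S. y \<le> z \<and> z < x}"
        using f[OF less.prems(1)] le by force
      moreover have "finite {z \<in> S. y \<le> z \<and> z < x}"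
        by (rule finite_subset[OF _ fin[OF pos[OF less.prems(2)], of x]]) auto
      ultimately have "card {z \<in> S. y \<le> z \<and> z < f x} < card {z \<in> S. y \<le> z \<and> z < x}"
        by (intro psubset_card_mono)
      then obtain n where "(f ^^ n) (f x) = y" using less.hyps f less.prems le by blast
      then show ?thesis by (intro exI[of _ "Suc n"]) (simp add: funpow_swap1)
    qed
  qed
  show "S = range (voronoi_chain K)"
  proof
    show "range (voronoi_chain K) \<subseteq> S"
      using fS[OF one] gS[OF one] unfolding g_def f_def by (auto simp: voronoi_chain_def S_def)
    show "S \<subseteq> range (voronoi_chain K)"
    proof
      fix x assume x: "x \<in> S"
      show "x \<in> range (voronoi_chain K)"
      proof (cases "x \<le> 1")
        case True
        then obtain n where "(f ^^ n) 1 = x" using reach one x by blast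
        then have "voronoi_chain K (int n) = x" by (simp add: voronoi_chain_def f_def)
        then show ?thesis by blast
      next
        case False
        then obtain n where n: "(f ^^ n) x = 1" using reach one x by force
        then have "n \<noteq> 0" using False by (intro notI) simp
        moreover have "(g ^^ n) 1 = x" using gf[OF x, of n] n by simp
        ultimately have "voronoi_chain K (- int n) = x"
          by (simp add: voronoi_chain_def f_def g_def S_def)
        then show ?thesis by blast
      qed
    qed
  qed
qed

section \<open>Bounds for the coordinates of lattice points\<close>

context trinomial_field
begin

lemma emb_omega_zcomb:
  "Re (emb \<omega> (zcomb \<theta> a c d)) = of_int a + of_int c * (- \<theta> / 2) + of_int d * (\<theta>\<^sup>2 / 4 - (Im \<omega>)\<^sup>2)"
  "Im (emb \<omega> (zcomb \<theta> a c d)) = Im \<omega> * (of_int c - of_int d * \<theta>)"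
  unfolding zcomb_eq_qcomb emb_qcomb
  by (simp_all add: qcomb_def Re_omega Re_power2 Im_power2 power_divide algebra_simps)

text \<open>The differences between an element and its conjugates no longer contain the coordinate a.
  They bound \<open>c - d * \<theta>\<close> through the imaginary part, and then d through the real part.\<close>

lemma zcomb_coordinate_bounds:
  fixes a c d :: int
  defines "x \<equiv> zcomb \<theta> a c d"
  defines "k \<equiv> cmod (emb \<omega> x)"
  shows "\<bar>of_int c - of_int d * \<theta>\<bar> * Im \<omega> \<le> k"
    and "\<bar>of_int d\<bar> * (p + 3 * \<theta>\<^sup>2) \<le> \<bar>x\<bar> + k + 3 / 2 * \<theta> * \<bar>of_int c - of_int d * \<theta>\<bar>"
proof -
  have R: "\<bar>Re (emb \<omega> x)\<bar> \<le> k" and I: "\<bar>Im (emb \<omega> x)\<bar> \<le> k"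
    unfolding k_def by (rule abs_Re_le_cmod, rule abs_Im_le_cmod)
  show "\<bar>of_int c - of_int d * \<theta>\<bar> * Im \<omega> \<le> k"
    using I Im_omega_pos unfolding x_def emb_omega_zcomb by (simp add: abs_mult mult.commute)
  have "x - Re (emb \<omega> x) = 3 / 2 * \<theta> * (of_int c - of_int d * \<theta>) + of_int d * (9 / 4 * \<theta>\<^sup>2 + (Im \<omega>)\<^sup>2)"
    unfolding x_def emb_omega_zcomb by (simp add: zcomb_def field_simps power2_eq_square)
  also have "9 / 4 * \<theta>\<^sup>2 + (Im \<omega>)\<^sup>2 = p + 3 * \<theta>\<^sup>2" unfolding Im_omega_sq by simp
  finally have "of_int d * (p + 3 * \<theta>\<^sup>2) = x - Re (emb \<omega> x) - 3 / 2 * \<theta> * (of_int c - of_int d * \<theta>)"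
    by simp
  then have "\<bar>of_int d * (p + 3 * \<theta>\<^sup>2)\<bar> \<le> \<bar>x\<bar> + \<bar>Re (emb \<omega> x)\<bar> + \<bar>3 / 2 * \<theta> * (of_int c - of_int d * \<theta>)\<bar>"
    by linarith
  moreover have "\<bar>3 / 2 * \<theta> * (of_int c - of_int d * \<theta>)\<bar> = 3 / 2 * \<theta> * \<bar>of_int c - of_int d * \<theta>\<bar>"
    using theta_pos by (simp add: abs_mult)
  moreover have "\<bar>of_int d * (p + 3 * \<theta>\<^sup>2)\<bar> = \<bar>of_int d\<bar> * (p + 3 * \<theta>\<^sup>2)"
    using p_ge_6 by (simp add: abs_mult abs_of_nonneg)
  ultimately show "\<bar>of_int d\<bar> * (p + 3 * \<theta>\<^sup>2) \<le> \<bar>x\<bar> + k + 3 / 2 * \<theta> * \<bar>of_int c - of_int d * \<theta>\<bar>"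
    using R by linarith
qed

lemma conj_norm_theta: "conj_norm \<theta> = \<theta>\<^sup>2 + p"
  by (simp add: conj_norm_def emb_theta cmod_omega_sq)

lemma norm_theta: "\<theta> * conj_norm \<theta> = of_int b"
  using theta_cubed by (simp add: conj_norm_theta algebra_simps power2_eq_square power3_eq_cube)

text \<open>The coordinate bounds with \<open>Im \<omega> \<ge> sqrt p\<close> give \<open>\<bar>c - d * \<theta>\<bar> < 6 / 5\<close>, slightly more than
  1, and then \<open>\<bar>d\<bar> * p < p\<close>. What remains are the numbers \<open>a + c * \<theta>\<close> with \<open>\<bar>c\<bar> \<le> 1\<close>, which are too large
  because \<open>\<theta> < 1 / 3\<close>.\<close>

lemma lattice_point_below_theta_eq_0:
  assumes x: "x = zcomb \<theta> a c d" and lt: "\<bar>x\<bar> < \<theta>" and conj_norm: "conj_norm x < conj_norm \<theta>"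
  shows "x = 0"
proof -
  define k where "k = cmod (emb \<omega> x)"
  have k2: "k\<^sup>2 < \<theta>\<^sup>2 + p" using conj_norm unfolding conj_norm_theta by (simp add: conj_norm_def k_def)
  note bd = zcomb_coordinate_bounds(1)[of c d a, folded x, folded k_def]
    zcomb_coordinate_bounds(2)[of d a c, folded x, folded k_def]
  have th2: "\<theta>\<^sup>2 < 1 / 9" using power_strict_mono[OF theta_less, of 2] theta_pos by (simp add: power_divide)
  have s2: "(Im \<omega>)\<^sup>2 \<ge> p" using Im_omega_sq by simp
  define t where "t = \<bar>of_int c - of_int d * \<theta>\<bar>"
  have t0: "t \<ge> 0" by (simp add: t_def)
  have "t\<^sup>2 * p \<le> t\<^sup>2 * (Im \<omega>)\<^sup>2" using s2 by (intro mult_left_mono) auto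
  also have "\<dots> = (t * Im \<omega>)\<^sup>2" by (simp add: power_mult_distrib)
  also have "\<dots> \<le> k\<^sup>2" using bd(1) t0 Im_omega_pos by (intro power_mono) (auto simp: t_def)
  also have "\<dots> < 4 / 3 * p" using k2 th2 p_ge_6 by linarith
  finally have "t\<^sup>2 < 4 / 3" using p_ge_6 by (subst (asm) mult_less_cancel_right_pos) auto
  then have t2: "t\<^sup>2 < (6 / 5)\<^sup>2" by (simp add: power2_eq_square)
  then have t: "t < 6 / 5" using t0 by (rule_tac power2_less_imp_less) auto
  \<comment> \<open>Here \<open>p \<ge> 6\<close> makes \<open>p + 1 / 9\<close> smaller than \<open>p\<^sup>2 / 4\<close>, so k is below \<open>p / 2\<close>.\<close>
  have "6 * p \<le> p * p" using p_ge_6 by (intro mult_right_mono) auto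
  then have "k\<^sup>2 < p * p / 4" using k2 th2 p_ge_6 by linarith
  also have "p * p / 4 = (p / 2)\<^sup>2" by (simp add: power2_eq_square)
  finally have "k\<^sup>2 < (p / 2)\<^sup>2" .
  then have k: "k < p / 2" using p_ge_6 by (rule_tac power2_less_imp_less) auto
  have tt: "\<theta> * t \<le> 1 / 3 * (6 / 5)" using theta_pos theta_less t t0 by (intro mult_mono) auto
  have "\<bar>of_int d\<bar> * p \<le> \<bar>of_int d\<bar> * (p + 3 * \<theta>\<^sup>2)" by (intro mult_left_mono) auto
  also have "\<dots> \<le> \<bar>x\<bar> + k + 3 / 2 * (\<theta> * t)" using bd(2) by (simp add: t_def)
  also have "\<dots> < 1 * p" using lt theta_less k tt p_ge_6 by linarith
  finally have "\<bar>real_of_int d\<bar> < 1" using p_ge_6 by (subst (asm) mult_less_cancel_right_pos) auto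
  then have d: "d = 0" by linarith
  then have c: "\<bar>c\<bar> \<le> 1" using t unfolding t_def d by simp
  have xx: "x = of_int a + of_int c * \<theta>" unfolding x zcomb_def d by simp
  from c consider "c = 0" | "c = 1" | "c = -1" by linarith
  then show "x = 0"
  proof cases
    case 1
    then have "\<bar>real_of_int a\<bar> < 1" using lt xx theta_less by simp
    then show ?thesis using xx 1 by simp
  next
    case 2
    have "a = 0" using lt xx theta_less 2 by simp
    then show ?thesis using xx 2 lt by simp
  next
    case 3
    have "a = 0" using lt xx theta_less 3 by simp
    then show ?thesis using xx 3 lt by simp
  qed
qed

text \<open>Bounds on the value and on the conjugates bound all three coordinates.\<close>

lemma finite_zcomb_bounded:
  "finite {zcomb \<theta> a c d | a c d. \<bar>zcomb \<theta> a c d\<bar> \<le> M \<and> conj_norm (zcomb \<theta> a c d) \<le> K}"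
proof -
  define k where "k = sqrt K"
  define E where "E = k / Im \<omega>"
  define F where "F = M + k + 3 / 2 * \<theta> * E"
  define G where "G = E + F * \<theta>"
  define H where "H = M + G * \<theta> + F * \<theta>\<^sup>2"
  define N where "N = \<lceil>max F (max G H)\<rceil>"
  have "{zcomb \<theta> a c d | a c d. \<bar>zcomb \<theta> a c d\<bar> \<le> M \<and> conj_norm (zcomb \<theta> a c d) \<le> K}
    \<subseteq> (\<lambda>(a, c, d). zcomb \<theta> a c d) ` ({-N..N} \<times> {-N..N} \<times> {-N..N})"
  proof safe
    fix a c d assume M: "\<bar>zcomb \<theta> a c d\<bar> \<le> M" and K: "conj_norm (zcomb \<theta> a c d) \<le> K"
    have k: "cmod (emb \<omega> (zcomb \<theta> a c d)) \<le> k"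
      unfolding k_def by (rule real_le_rsqrt) (use K in \<open>simp add: conj_norm_def\<close>)
    define t where "t = \<bar>of_int c - of_int d * \<theta>\<bar>"
    have tE: "t \<le> E" using zcomb_coordinate_bounds(1)[of c d a] k Im_omega_pos
      by (simp add: E_def t_def pos_le_divide_eq)
    have "\<bar>of_int d\<bar> * 1 \<le> \<bar>of_int d\<bar> * (p + 3 * \<theta>\<^sup>2)"
      using p_ge_6 zero_le_power2[of \<theta>] by (intro mult_left_mono) linarith+
    also have "\<dots> \<le> M + k + 3 / 2 * \<theta> * t"
      using zcomb_coordinate_bounds(2)[of d a c] k M by (simp add: t_def)
    also have "\<dots> \<le> F" unfolding F_def using tE theta_pos by (intro add_mono mult_left_mono) auto
    finally have dF: "\<bar>real_of_int d\<bar> \<le> F" by simp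
    have "\<bar>real_of_int d * \<theta>\<bar> \<le> F * \<theta>" using dF theta_pos by (simp add: abs_mult)
    then have cG: "\<bar>real_of_int c\<bar> \<le> G" using tE unfolding G_def t_def by linarith
    have "\<bar>real_of_int c * \<theta>\<bar> \<le> G * \<theta>" using cG theta_pos by (simp add: abs_mult)
    moreover have "\<bar>real_of_int d * \<theta>\<^sup>2\<bar> \<le> F * \<theta>\<^sup>2" using dF theta_pos by (simp add: abs_mult mult_right_mono)
    ultimately have aH: "\<bar>real_of_int a\<bar> \<le> H" using M unfolding H_def zcomb_def by linarith
    have "\<bar>a\<bar> \<le> N \<and> \<bar>c\<bar> \<le> N \<and> \<bar>d\<bar> \<le> N"
      unfolding N_def using aH cG dF by (simp add: le_ceiling_iff) linarith
    then show "zcomb \<theta> a c d \<in> (\<lambda>(a, c, d). zcomb \<theta> a c d) ` ({-N..N} \<times> {-N..N} \<times> {-N..N})"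
      by (intro image_eqI[of _ _ "(a, c, d)"]) auto
  qed
  then show ?thesis by (rule finite_subset) auto
qed

end

section \<open>Lattice minima and units\<close>

context monogenic_trinomial_field
begin

lemma lattice_minima_iff:
  "\<alpha> \<in> lattice_minima L \<longleftrightarrow> \<alpha> \<in> maximal_order L \<and> \<alpha> > 0 \<and>
     (\<forall>\<nu>\<in>maximal_order L. \<nu> \<noteq> 0 \<longrightarrow> \<bar>\<nu>\<bar> < \<alpha> \<longrightarrow> conj_norm \<alpha> \<le> conj_norm \<nu>)"
  unfolding lattice_minima_def using complex_conj_norm_eq order_in_L
  by (auto simp: not_less)

lemma theta_lattice_minimum: "\<theta> \<in> lattice_minima L"
  unfolding lattice_minima_iff using lattice_point_below_theta_eq_0 theta_pos theta_in_order
  by (auto elim!: order_cases intro: leI)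

lemma norm_ge_1:
  assumes "x \<in> maximal_order L" "x \<noteq> 0" shows "\<bar>x\<bar> * conj_norm x \<ge> 1"
proof -
  obtain a c d where x: "x = zcomb \<theta> a c d" using assms(1) by (rule order_cases)
  define N :: int where "N = norm_form a c d"
  have N: "x * conj_norm x = of_int N" unfolding x N_def by (rule norm_zcomb)
  have "x * conj_norm x \<noteq> 0" using assms conj_norm_pos[OF order_in_L[OF assms(1)]] by simp
  then have "N \<noteq> 0" using N by auto
  then have "\<bar>of_int N\<bar> \<ge> (1::real)" by simp
  then show ?thesis unfolding N[symmetric] abs_mult using conj_norm_nonneg[of x] by simp
qed

lemma positive_unitsD:
  assumes "u \<in> positive_units L"
  shows "u \<in> maximal_order L" "inverse u \<in> maximal_order L" "u > 0" "u \<in> L"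
  using assms order_in_L by (auto simp: positive_units_def order_units_def)

lemma positive_units_mult:
  "u \<in> positive_units L \<Longrightarrow> v \<in> positive_units L \<Longrightarrow> u * v \<in> positive_units L"
  by (auto simp: positive_units_def order_units_def order_mult inverse_mult_distrib)

lemma positive_units_inverse:
  "u \<in> positive_units L \<Longrightarrow> inverse u \<in> positive_units L"
  by (auto simp: positive_units_def order_units_def)

lemma positive_units_1: "1 \<in> positive_units L"
  by (simp add: positive_units_def order_units_def order_1)

lemma positive_units_power_int:
  assumes "u \<in> positive_units L" shows "u powi k \<in> positive_units L"
proof -
  have "v ^ n \<in> positive_units L" if "v \<in> positive_units L" for v n
    using that by (induction n) (auto intro: positive_units_1 positive_units_mult)
  then show ?thesis using assms positive_units_inverse by (simp add: power_int_def)
qed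

text \<open>Both u and its inverse have norm at least 1 in absolute value.\<close>

lemma order_unit_norm:
  assumes "u \<in> order_units L" shows "\<bar>u\<bar> * conj_norm u = 1"
proof (rule antisym)
  have u: "u \<in> maximal_order L" "inverse u \<in> maximal_order L" "u \<noteq> 0" "u \<in> L"
    using assms order_in_L by (auto simp: order_units_def)
  show "1 \<le> \<bar>u\<bar> * conj_norm u" by (rule norm_ge_1[OF u(1,3)])
  have "1 \<le> \<bar>inverse u\<bar> * conj_norm (inverse u)" using u by (intro norm_ge_1) auto
  also have "\<dots> = inverse (\<bar>u\<bar> * conj_norm u)" using u conj_norm_inverse[OF u(4,3)] by (simp add: inverse_mult_distrib)
  finally show "\<bar>u\<bar> * conj_norm u \<le> 1"
    unfolding one_le_inverse_iff by simp
qed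

text \<open>An element smaller than u in both respects would have norm less than 1 in absolute value.\<close>

lemma positive_unit_lattice_minimum:
  assumes u: "u \<in> positive_units L" shows "u \<in> lattice_minima L"
  unfolding lattice_minima_iff
proof (intro conjI ballI impI)
  show "u \<in> maximal_order L" "u > 0" using positive_unitsD[OF u] by auto
  fix \<nu> assume n: "\<nu> \<in> maximal_order L" "\<nu> \<noteq> 0" "\<bar>\<nu>\<bar> < u"
  show "conj_norm u \<le> conj_norm \<nu>"
  proof (rule ccontr)
    assume "\<not> conj_norm u \<le> conj_norm \<nu>"
    then have "\<bar>\<nu>\<bar> * conj_norm \<nu> < u * conj_norm u" using n conj_norm_nonneg by (intro mult_strict_mono) auto
    also have "\<dots> = 1" using order_unit_norm[of u] u by (simp add: positive_units_def)
    finally show False using norm_ge_1[OF n(1,2)] by simp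
  qed
qed

text \<open>Dividing by u turns an element that contradicts minimality of \<open>u * \<alpha>\<close> into one that
  contradicts minimality of \<open>\<alpha>\<close>.\<close>

lemma positive_unit_mult_lattice_minimum:
  assumes u: "u \<in> positive_units L" and a: "\<alpha> \<in> lattice_minima L"
  shows "u * \<alpha> \<in> lattice_minima L"
  unfolding lattice_minima_iff
proof (intro conjI ballI impI)
  have a': "\<alpha> \<in> maximal_order L" "\<alpha> > 0" using a by (auto simp: lattice_minima_iff)
  show "u * \<alpha> \<in> maximal_order L" "u * \<alpha> > 0" using positive_unitsD[OF u] a' by (auto intro: order_mult)
  fix \<nu> assume n: "\<nu> \<in> maximal_order L" "\<nu> \<noteq> 0" "\<bar>\<nu>\<bar> < u * \<alpha>"
  define \<mu> where "\<mu> = inverse u * \<nu>"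
  have "\<mu> \<in> maximal_order L" unfolding \<mu>_def using n positive_unitsD[OF u] by (intro order_mult)
  moreover have "\<mu> \<noteq> 0" "\<bar>\<mu>\<bar> < \<alpha>" and nu: "\<nu> = u * \<mu>"
    using n positive_unitsD[OF u] by (auto simp: \<mu>_def abs_mult field_simps)
  ultimately have "conj_norm \<alpha> \<le> conj_norm \<mu>" using a by (auto simp: lattice_minima_iff)
  then show "conj_norm (u * \<alpha>) \<le> conj_norm \<nu>" unfolding nu
    using positive_unitsD[OF u] order_in_L[OF a'(1)] order_in_L[OF \<open>\<mu> \<in> maximal_order L\<close>] conj_norm_nonneg \<open>conj_norm \<alpha> \<le> conj_norm \<mu>\<close>
    by (simp add: conj_norm_mult mult_left_mono)
qed

definition \<eta> :: real where "\<eta> = 1 - 3 * real r * \<theta>"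

lemma eta_bounds: "0 < \<eta>" "\<eta> < 1"
  using r_theta_less r_pos theta_pos by (auto simp: \<eta>_def)

lemma eta_eq: "\<eta> = \<theta> ^ 3 / of_int b"
  using b_ge_2 by (simp add: \<eta>_def theta_cubed diff_divide_distrib)

text \<open>The inverse comes from \<open>1 / \<eta> = b / \<theta> ^ 3 = 1 + p / \<theta>\<^sup>2\<close>, where \<open>b / \<theta> = \<theta>\<^sup>2 + p\<close> is integral
  and \<open>b / \<theta>\<^sup>2 = \<theta> + 3 * r * (b / \<theta>)\<close>.\<close>

lemma eta_unit: "\<eta> \<in> positive_units L"
proof -
  have e: "\<eta> = zcomb \<theta> 1 (- 3 * int r) 0" by (simp add: \<eta>_def zcomb_def)
  have "\<eta> * zcomb \<theta> (1 + 27 * int r ^ 3 * b) (3 * int r) (9 * (int r)\<^sup>2)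
    = 1 + 27 * real r ^ 3 * (of_int b - p * \<theta> - \<theta> ^ 3)"
    by (simp add: \<eta>_def zcomb_def algebra_simps power2_eq_square power3_eq_cube)
  then have "\<eta> * zcomb \<theta> (1 + 27 * int r ^ 3 * b) (3 * int r) (9 * (int r)\<^sup>2) = 1"
    by (simp add: theta_cubed)
  then have "inverse \<eta> = zcomb \<theta> (1 + 27 * int r ^ 3 * b) (3 * int r) (9 * (int r)\<^sup>2)"
    by (rule inverse_unique)
  then show ?thesis
    using eta_bounds e by (auto simp: positive_units_def order_units_def)
qed

lemma eta_power_unit: "\<eta> powi k \<in> positive_units L"
  by (rule positive_units_power_int[OF eta_unit])

lemma minima_below: "0 < x \<Longrightarrow> \<exists>u\<in>positive_units L. u < x"
proof -
  assume "0 < x"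
  then obtain n where "\<eta> ^ n < x" using real_arch_pow_inv eta_bounds by blast
  then show ?thesis using eta_power_unit[of "int n"] by auto
qed

lemma minima_above: "\<exists>u\<in>positive_units L. x < u"
proof -
  have "0 < inverse (max x 1)" by simp
  then obtain u where u: "u \<in> positive_units L" "u < inverse (max x 1)" using minima_below by blast
  then have "inverse (inverse (max x 1)) < inverse u"
    using positive_unitsD[OF u(1)] by (intro less_imp_inverse_less) auto
  then show ?thesis using positive_units_inverse[OF u(1)] by auto
qed

text \<open>A unit u below the interval bounds the conjugates of all minima in it: none of them may be
  beaten by u.\<close>

lemma finite_minima_interval:
  assumes "0 < x" shows "finite (lattice_minima L \<inter> {x..y})"
proof -
  obtain u where u: "u \<in> positive_units L" "u < x" using minima_below[OF assms] by blast
  have "lattice_minima L \<inter> {x..y} \<subseteq>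
    {zcomb \<theta> a c d | a c d. \<bar>zcomb \<theta> a c d\<bar> \<le> y \<and> conj_norm (zcomb \<theta> a c d) \<le> conj_norm u}"
  proof
    fix \<alpha> assume a: "\<alpha> \<in> lattice_minima L \<inter> {x..y}"
    then obtain a c d where i: "\<alpha> = zcomb \<theta> a c d" by (auto simp: lattice_minima_iff elim: order_cases)
    have "conj_norm \<alpha> \<le> conj_norm u" using a u positive_unitsD[OF u(1)] by (auto simp: lattice_minima_iff)
    moreover have "\<bar>\<alpha>\<bar> \<le> y" using a by (auto simp: lattice_minima_iff)
    ultimately show "\<alpha> \<in> {zcomb \<theta> a c d | a c d. \<bar>zcomb \<theta> a c d\<bar> \<le> y \<and> conj_norm (zcomb \<theta> a c d) \<le> conj_norm u}"
      using i by blast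
  qed
  then show ?thesis by (rule finite_subset[OF _ finite_zcomb_bounded])
qed

theorem voronoi_chain_exhausts:
  "bij_betw (next_minimum L) (lattice_minima L) (lattice_minima L)"
  "lattice_minima L = range (voronoi_chain L)"
proof -
  have below: "\<exists>y\<in>lattice_minima L. y < x" if "0 < x" for x
    using minima_below[OF that] positive_unit_lattice_minimum by blast
  have above: "\<exists>y\<in>lattice_minima L. x < y" for x
    using minima_above[of x] positive_unit_lattice_minimum by blast
  note one = positive_unit_lattice_minimum[OF positive_units_1]
  show "bij_betw (next_minimum L) (lattice_minima L) (lattice_minima L)"
    by (rule discrete_minima_chain; fact finite_minima_interval below above one)
  show "lattice_minima L = range (voronoi_chain L)"
    by (rule discrete_minima_chain; fact finite_minima_interval below above one)
qed

text \<open>Positive units are lattice minima, so they are discrete, and \<open>\<eta>\<close> is one of them below 1. The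
  greatest unit below 1 generates: dividing a unit by a suitable power leaves a unit in the interval
  from \<open>\<epsilon>\<close> (excluded) to 1 (included), which can only be 1.\<close>

lemma fundamental_unit:
  obtains \<epsilon> where "\<epsilon> \<in> positive_units L" "\<And>u. u \<in> positive_units L \<Longrightarrow> \<exists>k. u = \<epsilon> powi k"
proof -
  define Z where "Z = positive_units L \<inter> {\<eta>..<1}"
  have "finite Z"
    by (rule finite_subset[OF _ finite_minima_interval[OF eta_bounds(1), of 1]])
       (auto simp: Z_def positive_unit_lattice_minimum)
  moreover have eZ: "\<eta> \<in> Z" using eta_unit eta_bounds by (simp add: Z_def)
  ultimately have m: "Max Z \<in> Z" "\<And>z. z \<in> Z \<Longrightarrow> z \<le> Max Z" by (auto intro: Max_in)
  define \<epsilon> where "\<epsilon> = Max Z"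
  have e: "\<epsilon> \<in> positive_units L" "\<eta> \<le> \<epsilon>" "\<epsilon> < 1" "\<epsilon> > 0"
    using m(1) eta_bounds by (auto simp: Z_def \<epsilon>_def)
  have "\<exists>k. u = \<epsilon> powi k" if u: "u \<in> positive_units L" for u
  proof -
    have ln: "ln \<epsilon> < 0" using e by simp
    have u0: "u > 0" using positive_unitsD[OF u] by simp
    \<comment> \<open>As \<open>ln \<epsilon>\<close> is negative, this is the greatest k with \<open>u \<le> \<epsilon> powi k\<close>.\<close>
    define k where "k = \<lfloor>ln u / ln \<epsilon>\<rfloor>"
    define v where "v = u * inverse (\<epsilon> powi k)"
    have v: "v \<in> positive_units L"
      unfolding v_def by (intro positive_units_mult u positive_units_inverse positive_units_power_int e)
    have v0: "v > 0" using positive_unitsD[OF v] by simp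
    have "\<epsilon> powi k = \<epsilon> powr of_int k" using e by (simp add: powr_real_of_int')
    then have lnv: "ln v = ln u - of_int k * ln \<epsilon>"
      using u0 e by (simp add: v_def ln_mult ln_inverse ln_powr)
    have "of_int k \<le> ln u / ln \<epsilon>" "ln u / ln \<epsilon> < of_int k + 1" unfolding k_def by linarith+
    then have "ln v \<le> 0" "ln \<epsilon> < ln v" unfolding lnv using ln by (auto simp: field_simps)
    then have "v \<le> 1" "\<epsilon> < v" using v0 e by auto
    have "v \<notin> Z" using m(2)[of v] \<open>\<epsilon> < v\<close> by (auto simp: \<epsilon>_def)
    then have "\<not> v < 1" using v e(2) \<open>\<epsilon> < v\<close> by (simp add: Z_def)
    then have "v = 1" using \<open>v \<le> 1\<close> by linarith
    then show ?thesis using e by (auto simp: v_def field_simps)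
  qed
  then show thesis using that e by blast
qed

text \<open>Multiplication by a rational number between 0 and 1 decreases the value and the conjugates
  alike, so the larger one of two proportional minima is beaten by the smaller one.\<close>

lemma rational_multiple_of_minimum:
  assumes a: "\<alpha> \<in> lattice_minima L" and b: "\<beta> \<in> lattice_minima L" and q: "q \<in> \<rat>" and e: "\<alpha> = q * \<beta>"
  shows "\<alpha> = \<beta>"
proof -
  have not_less: "\<not> \<gamma> < \<delta>"
    if "\<gamma> \<in> lattice_minima L" "\<delta> \<in> lattice_minima L" "q \<in> \<rat>" "\<gamma> = q * \<delta>" for \<gamma> \<delta> q
  proof
    assume lt: "\<gamma> < \<delta>"
    have p: "\<gamma> > 0" "\<delta> > 0" "\<gamma> \<in> maximal_order L" "\<delta> \<in> L"
      using that order_in_L by (auto simp: lattice_minima_iff)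
    have q: "0 < q" "q < 1" using lt p that(4) by (auto simp: zero_less_mult_iff)
    obtain q' where q': "q = of_rat q'" using \<open>q \<in> \<rat>\<close> by (auto elim: Rats_cases)
    have "conj_norm \<gamma> = q\<^sup>2 * conj_norm \<delta>" using p by (simp add: that(4) q' conj_norm_mult L_of_rat conj_norm_of_rat)
    also have "\<dots> < 1 * conj_norm \<delta>" using q p conj_norm_pos[of \<delta>]
      by (intro mult_strict_right_mono) (auto simp: power_less_one_iff)
    finally show False using that(2) p lt by (auto simp: lattice_minima_iff)
  qed
  have p: "\<alpha> > 0" using a by (simp add: lattice_minima_iff)
  then have "q \<noteq> 0" using e by auto
  then have "\<beta> = inverse q * \<alpha>" using e by simp
  then have "\<not> \<beta> < \<alpha>" using not_less[OF b a, of "inverse q"] q by simp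
  then show ?thesis using not_less[OF a b q e] by simp
qed

text \<open>If \<open>\<theta>\<close> and a rational q generated the same ideal, then q would be a multiple of \<open>\<theta>\<close>, and rational
  multiples of \<open>\<theta>\<close> in the order are multiples of b. On the other hand \<open>\<theta>\<close> would be divisible by q, but
  its coordinates are coprime.\<close>

lemma dpf_theta: "differential_principal_factor L \<theta>"
  unfolding differential_principal_factor_def
proof (intro conjI)
  show "\<theta> \<in> maximal_order L" by (rule theta_in_order)
  show "\<theta> \<notin> order_units L" using order_unit_norm[of \<theta>] norm_theta theta_pos b_ge_2 by auto
  have "\<theta> ^ 3 / field_norm L \<theta> = \<eta>"
    by (simp add: field_norm_eq theta_in_L norm_theta eta_eq)
  then show "\<theta> ^ 3 / field_norm L \<theta> \<in> order_units L" using eta_unit by (simp add: positive_units_def)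
  show "\<not> (\<exists>q\<in>\<rat>. (*) \<theta> ` maximal_order L = (*) q ` maximal_order L)"
  proof
    assume "\<exists>q\<in>\<rat>. (*) \<theta> ` maximal_order L = (*) q ` maximal_order L"
    then obtain q where eq: "(*) \<theta> ` maximal_order L = (*) (of_rat q) ` maximal_order L"
      by (auto elim!: Rats_cases)
    have "of_rat q \<in> (*) (of_rat q) ` maximal_order L" using order_1 by force
    then obtain x where x: "x \<in> maximal_order L" "of_rat q = \<theta> * x" using eq by auto
    from x(1) obtain a c d where acd: "x = zcomb \<theta> a c d" by (rule order_cases)
    have "qcomb \<theta> q 0 0 = qcomb \<theta> (of_int b * of_int d) (of_int a - 3 * of_nat r * of_int b * of_int d) (of_int c)"
      using x(2) qcomb_mult[OF zero_theta, of 0 1 0 "of_int a" "of_int c" "of_int d"]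
      unfolding acd zcomb_eq_qcomb of_rat_eq_qcomb[of q \<theta>] generator_eq_qcomb[of \<theta>, symmetric] by simp
    then have q: "q = of_int (b * d)" by (simp add: qcomb_eq_iff[OF zero_theta])
    have "\<theta> \<in> (*) (of_rat q) ` maximal_order L" using eq order_1 by force
    then obtain y where y: "y \<in> maximal_order L" "\<theta> = of_rat q * y" by auto
    from y(1) obtain a' c' d' where y': "y = zcomb \<theta> a' c' d'" by (rule order_cases)
    have "zcomb \<theta> 0 1 0 = zcomb \<theta> (b * d * a') (b * d * c') (b * d * d')"
      using y(2) unfolding y' q of_rat_of_int_eq by (simp add: zcomb_def algebra_simps)
    then have "(of_int (b * d * c') :: rat) = of_int 1"
      unfolding zcomb_eq_qcomb qcomb_eq_iff[OF zero_theta] by simp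
    then have "b * (d * c') = 1" unfolding of_int_eq_iff by (simp add: mult.assoc)
    then have "b dvd 1" by (metis dvd_triv_left)
    then show False using b_ge_2 by simp
  qed
qed

lemma unit_multiple_image:
  assumes u: "u \<in> positive_units L"
  shows "(*) (q * u) ` maximal_order L = (*) q ` maximal_order L"
proof (intro equalityI subsetI)
  fix x assume "x \<in> (*) (q * u) ` maximal_order L"
  then obtain y where "y \<in> maximal_order L" "x = q * (u * y)" by (auto simp: mult.assoc)
  then show "x \<in> (*) q ` maximal_order L" using positive_unitsD[OF u] order_mult by blast
next
  fix x assume "x \<in> (*) q ` maximal_order L"
  then obtain y where "y \<in> maximal_order L" "x = q * u * (inverse u * y)"
    using positive_unitsD(3)[OF u] by auto
  then show "x \<in> (*) (q * u) ` maximal_order L" using positive_unitsD[OF u] order_mult by blast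
qed

text \<open>The unit u is the cube root of the quotient of the two given powers of \<open>\<epsilon>\<close>. Then
  \<open>\<alpha> / (u * \<beta>)\<close> has the cube \<open>N \<alpha> / N \<beta>\<close>, which is rational.\<close>

lemma same_cube_class_imp_rational_multiple:
  assumes a: "\<alpha> \<in> L" "\<alpha> > 0" and b: "\<beta> \<in> L" "\<beta> > 0"
    and e: "\<epsilon> \<in> positive_units L"
    and ea: "\<alpha> ^ 3 / (\<alpha> * conj_norm \<alpha>) = \<epsilon> powi i" and eb: "\<beta> ^ 3 / (\<beta> * conj_norm \<beta>) = \<epsilon> powi j"
    and ij: "i mod 3 = j mod 3"
  obtains u q where "u \<in> positive_units L" "q \<in> \<rat>" "\<alpha> = q * (u * \<beta>)"
proof -
  obtain k where k: "i - j = 3 * k" using ij by (auto simp: mod_eq_dvd_iff elim: dvdE)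
  define u where "u = \<epsilon> powi k"
  have u: "u \<in> positive_units L" unfolding u_def by (rule positive_units_power_int[OF e])
  have e0: "\<epsilon> > 0" using positive_unitsD[OF e] by simp
  have u0: "u > 0" using positive_unitsD[OF u] by simp
  have "u ^ 3 = \<epsilon> powi (i - j)" unfolding u_def k by (simp add: power_int_mult mult.commute)
  also have "\<dots> = \<epsilon> powi i / \<epsilon> powi j" using e0 by (simp add: power_int_diff)
  also have "\<dots> = (\<alpha> ^ 3 / (\<alpha> * conj_norm \<alpha>)) / (\<beta> ^ 3 / (\<beta> * conj_norm \<beta>))" by (simp only: ea eb)
  finally have u3: "u ^ 3 = (\<alpha> ^ 3 / (\<alpha> * conj_norm \<alpha>)) / (\<beta> ^ 3 / (\<beta> * conj_norm \<beta>))" .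
  define q where "q = \<alpha> / (u * \<beta>)"
  have "q ^ 3 = (\<alpha> * conj_norm \<alpha>) / (\<beta> * conj_norm \<beta>)"
    unfolding q_def power_divide power_mult_distrib u3
    using a b conj_norm_pos[of \<alpha>] conj_norm_pos[of \<beta>] by (simp add: field_simps)
  also have "\<dots> \<in> \<rat>" using norm_rational a b by (intro Rats_divide) auto
  finally have q3: "q ^ 3 \<in> \<rat>" .
  have "q \<in> L" unfolding q_def using a b positive_unitsD[OF u] by (intro L_divide L_mult) auto
  then have "q \<in> \<rat>" using q3 by (rule cube_rational_imp_rational)
  moreover have "\<alpha> = q * (u * \<beta>)" using u0 b by (simp add: q_def)
  ultimately show thesis using that u by blast
qed

text \<open>The exponent of \<open>\<alpha> ^ 3 / N \<alpha>\<close> modulo 3 is an invariant of the orbit of \<open>\<alpha>\<close> that separates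
  orbits. It does not vanish, since the class of the exponent 0 is that of the rational numbers.\<close>

theorem dpf_orbits_card: "finite (dpf_orbits L)" "card (dpf_orbits L) \<in> {1, 2}"
proof -
  obtain \<epsilon> where e: "\<epsilon> \<in> positive_units L" and gen: "\<And>u. u \<in> positive_units L \<Longrightarrow> \<exists>k. u = \<epsilon> powi k"
    by (rule fundamental_unit) blast
  define A where "A = {\<alpha> \<in> lattice_minima L. differential_principal_factor L \<alpha>}"
  define orb where "orb \<alpha> = (\<lambda>\<epsilon>. \<epsilon> * \<alpha>) ` positive_units L" for \<alpha>
  have orbits: "dpf_orbits L = orb ` A" by (simp add: dpf_orbits_def A_def orb_def)
  have AL: "\<alpha> \<in> L" "\<alpha> > 0" if "\<alpha> \<in> A" for \<alpha>
    using that order_in_L by (auto simp: A_def lattice_minima_iff)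
  have "\<forall>\<alpha>\<in>A. \<exists>k. \<alpha> ^ 3 / (\<alpha> * conj_norm \<alpha>) = \<epsilon> powi k"
  proof
    fix \<alpha> assume a: "\<alpha> \<in> A"
    have "\<alpha> ^ 3 / (\<alpha> * conj_norm \<alpha>) \<in> order_units L"
      using a AL[OF a] by (simp add: A_def differential_principal_factor_def field_norm_eq)
    moreover have "\<alpha> ^ 3 / (\<alpha> * conj_norm \<alpha>) > 0" using AL[OF a] conj_norm_pos[of \<alpha>] by simp
    ultimately show "\<exists>k. \<alpha> ^ 3 / (\<alpha> * conj_norm \<alpha>) = \<epsilon> powi k"
      by (intro gen) (simp add: positive_units_def)
  qed
  then obtain k where k: "\<And>\<alpha>. \<alpha> \<in> A \<Longrightarrow> \<alpha> ^ 3 / (\<alpha> * conj_norm \<alpha>) = \<epsilon> powi k \<alpha>" by metis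
  have k0: "k \<alpha> mod 3 \<in> {1, 2}" if a: "\<alpha> \<in> A" for \<alpha>
  proof -
    have "k \<alpha> mod 3 \<noteq> 0"
    proof
      assume "k \<alpha> mod 3 = 0"
      \<comment> \<open>The number 1 has exponent 0, so \<open>\<alpha>\<close> is a rational multiple of a unit.\<close>
      moreover have "1 ^ 3 / (1 * conj_norm 1) = \<epsilon> powi 0" using conj_norm_of_rat[of 1] by simp
      ultimately obtain u q where uq: "u \<in> positive_units L" "q \<in> \<rat>" "\<alpha> = q * (u * 1)"
        using same_cube_class_imp_rational_multiple[OF AL[OF a] _ _ e k[OF a], of 1 0] L_of_rat[of 1] by auto
      then have "(*) \<alpha> ` maximal_order L = (*) q ` maximal_order L" using unit_multiple_image by simp
      then show False using a uq by (auto simp: A_def differential_principal_factor_def)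
    qed
    moreover have "0 \<le> k \<alpha> mod 3" "k \<alpha> mod 3 < 3" by simp_all
    ultimately show ?thesis by auto
  qed
  have same: "orb \<alpha> = orb \<beta>" if a: "\<alpha> \<in> A" and b: "\<beta> \<in> A" and kk: "k \<alpha> mod 3 = k \<beta> mod 3" for \<alpha> \<beta>
  proof -
    obtain u q where uq: "u \<in> positive_units L" "q \<in> \<rat>" "\<alpha> = q * (u * \<beta>)"
      by (rule same_cube_class_imp_rational_multiple[OF AL[OF a] AL[OF b] e k[OF a] k[OF b] kk])
    have "\<alpha> = u * \<beta>"
      using a b uq by (intro rational_multiple_of_minimum[of \<alpha> "u * \<beta>" q] positive_unit_mult_lattice_minimum)
        (auto simp: A_def)
    then have "orb \<alpha> = (\<lambda>v. v * \<beta>) ` (\<lambda>v. v * u) ` positive_units L"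
      by (simp add: orb_def image_image mult.assoc)
    also have "(\<lambda>v. v * u) ` positive_units L = positive_units L"
    proof (intro equalityI subsetI)
      fix v assume "v \<in> positive_units L"
      then have "v * inverse u \<in> positive_units L" using uq by (intro positive_units_mult positive_units_inverse)
      moreover have "v = v * inverse u * u" using positive_unitsD(3)[OF uq(1)] by simp
      ultimately show "v \<in> (\<lambda>v. v * u) ` positive_units L" by blast
    qed (use uq positive_units_mult in auto)
    finally show ?thesis by (simp add: orb_def)
  qed
  \<comment> \<open>The orbit is a function of the residue.\<close>
  define h where "h i = orb (SOME \<alpha>. \<alpha> \<in> A \<and> k \<alpha> mod 3 = i)" for i
  have "orb \<alpha> = h (k \<alpha> mod 3)" if a: "\<alpha> \<in> A" for \<alpha>
  proof -
    have "(SOME \<beta>. \<beta> \<in> A \<and> k \<beta> mod 3 = k \<alpha> mod 3) \<in> A \<and>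
      k (SOME \<beta>. \<beta> \<in> A \<and> k \<beta> mod 3 = k \<alpha> mod 3) mod 3 = k \<alpha> mod 3"
      by (rule someI[of _ \<alpha>]) (simp add: a)
    then show ?thesis unfolding h_def by (intro same[OF a]) auto
  qed
  then have sub: "dpf_orbits L \<subseteq> h ` {1, 2}" unfolding orbits using k0 by blast
  then show fin: "finite (dpf_orbits L)" by (rule finite_subset) simp
  have "card (dpf_orbits L) \<le> card (h ` {1, 2})" by (rule card_mono[OF _ sub]) simp
  also have "\<dots> \<le> card {1, 2 :: int}" by (rule card_image_le) simp
  finally have "card (dpf_orbits L) \<le> 2" by simp
  moreover have "dpf_orbits L \<noteq> {}"
    using theta_lattice_minimum dpf_theta by (auto simp: orbits A_def)
  then have "card (dpf_orbits L) \<noteq> 0" using fin by simp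
  ultimately show "card (dpf_orbits L) \<in> {1, 2}" by auto
qed

end

section \<open>The theorem\<close>

theorem theorem5:
  fixes r :: nat and b :: int and P :: "int poly" and \<theta> :: real and L :: "real set"
  assumes "r > 0" and "b \<ge> 2" and "squarefree b"
    and "P = [:- b, 3 * int r * b, 0, 1:]"
    and "monogenic P"
    and "poly (map_poly of_int P) \<theta> = 0"
    and "L = rat_adjoin \<theta>"
  shows "poly_discriminant P = - 27 * b\<^sup>2 * (4 * int r ^ 3 * b + 1)
    \<and> poly_discriminant P < 0
    \<and> simply_real_cubic L
    \<and> field_discriminant L = poly_discriminant P
    \<and> maximal_order L = int_adjoin \<theta>
    \<and> differential_principal_factor L \<theta>
    \<and> \<theta> \<in> lattice_minima L
    \<and> bij_betw (next_minimum L) (lattice_minima L) (lattice_minima L)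
    \<and> lattice_minima L = range (voronoi_chain L)
    \<and> (\<exists>i::int. \<theta> = voronoi_chain L i)
    \<and> (M_chain 1 L \<or> M_chain 2 L)"
proof -
  interpret trinomial r b by unfold_locales (fact assms)+
  interpret trinomial_field r b \<theta>
    by unfold_locales (use assms(6) in \<open>simp add: is_zero_iff_poly assms(4)\<close>)
  obtain z :: complex where "is_zero z" "int_adjoin z = maximal_order (rat_adjoin z)"
    using \<open>monogenic P\<close> unfolding monogenic_def is_zero_iff_poly assms(4) by blast
  interpret monogenic_trinomial_field r b \<theta>
    by unfold_locales (rule monogenic_transfer, fact+)
  have disc: "poly_discriminant P = - 27 * b\<^sup>2 * (4 * int r ^ 3 * b + 1)"
    unfolding assms(4) poly_discriminant_depressed_cubic
    by (simp add: algebra_simps power2_eq_square power3_eq_cube)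
  have "4 * int r ^ 3 * b + 1 > 0" using b_ge_2 by simp
  then have "0 < 27 * b\<^sup>2 * (4 * int r ^ 3 * b + 1)" using b_ge_2 by (intro mult_pos_pos) auto
  then have neg: "poly_discriminant P < 0" unfolding disc by linarith
  have "\<exists>i. \<theta> = voronoi_chain (rat_adjoin \<theta>) i"
    using theta_lattice_minimum voronoi_chain_exhausts(2) by auto
  moreover have "M_chain 1 (rat_adjoin \<theta>) \<or> M_chain 2 (rat_adjoin \<theta>)"
    using dpf_orbits_card by (auto simp: M_chain_def)
  ultimately show ?thesis
    unfolding assms(7) using disc neg simply_real_cubic_L field_discriminant_L monogen dpf_theta
      theta_lattice_minimum voronoi_chain_exhausts by simp
qed

end
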